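(* Let $\mathbb T$ be a context, $\mathcal A$ an arithmetic universe, and $M_1$ a (not necessarily strict) model of $\mathbb T$ in $\mathcal A$. Then there is a unique strict model $M_0$ of $\mathbb T$ in $\mathcal A$ and isomorphism of models $\phi\colon M_0\cong M_1$.
   Context: **Arithmetic universes.** An arithmetic universe (AU) is a pretopos (a category with finite limits, stable finite disjoint coproducts, and stable effective quotients of equivalence relations) in which every object $A$ has a parametrized list object $\mathsf{List}(A)$, with maps $\varepsilon\colon 1\to\mathsf{List}(A)$ and $\mathsf{cons}\colon A\times\mathsf{List}(A)\to\mathsf{List}(A)$ such that for all $y\colon B\to Y$ and $g\colon A\times Y\to Y$ there is a unique $r\colon\mathsf{List}(A)\times B\to Y$ with $r([\,],b)=y(b)$ and $r(\mathsf{cons}(a,x),b)=g(a,r(x,b))$. Each AU is equipped with canonical choices of: a terminal object, a pullback cone for every opspan, an initial object, a pushout cocone for every span, and a list object $(\mathsf{List}(A),\varepsilon,\mathsf{cons})$ for every object $A$. The canonical product $X\times Y$ is the canonical pullback of $X\to 1\leftarrow Y$. **Sketches.** Composition of edges is written in diagrammatic order. A sketch $\mathbb T$ consists of sets of nodes, edges, commutativities, terminal universals, pullback universals, initial universals, pushout universals and list universals, with the following structure. Each edge has a domain node and a codomain node, and each node $X$ has an identity edge $\mathsf s(X)\colon X\to X$. Each commutativity has a triangle of edges $u\colon X\to Y$, $v\colon Y\to Z$, $w\colon X\to Z$; we write $uv\sim w$ to say that there is a commutativity with this triangle. Each terminal universal and each initial universal has a node. Each pullback universal has two commutativities $p^1u_1\sim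 p$ and $p^2u_2\sim p$ with the same third edge $p\colon P\to Z$. Each pushout universal has two commutativities $u_1q^1\sim q$ and $u_2q^2\sim q$ with the same third edge $q$. Each list universal has: a terminal universal, with node $T$; a pullback universal on an opspan $A\to T\leftarrow L$, with pullback node $P$ and projections $p^1\colon P\to A$, $p^2\colon P\to L$; and two edges $e\colon T\to L$ and $c\colon P\to L$. A sketch homomorphism is a family of functions, one for each sort, preserving all this structure. **Models.** A strict model of $\mathbb T$ in an AU $\mathcal A$ interprets nodes as objects and edges as morphisms of $\mathcal A$, respecting domains, codomains and identities, interpreting every commutativity $uv\sim w$ as an equation (the composite of $u$ then $v$ is $w$), and interpreting each universal as the canonical structure: the node of a terminal (initial) universal is the canonical terminal (initial) object; the edges $p^1,p^2$ of a pullback universal are the canonical projections of the pullback of $u_1,u_2$; the edges $q^1,q^2$ of a pushout universal are the canonical injections of the pushout of $u_1,u_2$; and for a list universal $e,c$ are the canonical $\varepsilon,\mathsf{cons}$ for $\mathsf{List}(A)$. A model is defined in the same way, except that each universal is only required to be interpreted by something with the appropriate universal property, not necessarily the canonical choice. A homomorphism of models is a family of carrier morphisms, one for each node, commuting with the interpretations of the edges; an isomorphism of models is an invertible homomorphism. **Extensions and contexts.** A simple extension of a sketch $\mathbb U$ is the inclusion of $\mathbb U$ in a sketch obtained by adjoining fresh ingredients in one of these ways: (1) a primitive node, with its identity edge; (2) a primitive edge $X\to Y$, for given nodes $X,Y$ of $\mathbb U$; (3) a commutativity $uv\sim w$, for a given triangle of edges of $\mathbb U$; (4) a terminal universal with a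 fresh node and its identity edge, or similarly an initial universal; (5) a pullback universal on a given opspan $u_1,u_2$ of edges of $\mathbb U$, with fresh node $P$ and its identity edge, fresh edges $p^1,p^2,p$ and two fresh commutativities, or dually a pushout universal; (6) a list universal on a given node $A$ of $\mathbb U$, with fresh nodes $T,L,P$ and their identity edges, fresh edges $e\colon T\to L$, $c\colon P\to L$, $p^1,p^2,p$, $A\to T$, $L\to T$, two fresh commutativities, a fresh terminal universal on $T$ and a fresh pullback universal with node $P$. An extension is a finite composite of simple extensions. A context is an extension of the empty sketch.
   Formalization: Uniqueness of the pair (M0, φ) is taken with φ the identity on primitive nodes (more generally, two pairs whose isomorphisms agree on primitive nodes are equal); literal uniqueness fails, e.g. for a context with one primitive node and a carrier with a nontrivial automorphism. *)

theory Defs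
  imports Main "HOL-Library.FuncSet"
begin

section \<open>Categories and universal properties\<close>

text \<open>Composition is written in diagrammatic order throughout.\<close>

record ('o, 'm) cat =
  Obj :: "'o set"
  Arr :: "'m set"
  Dom :: "'m \<Rightarrow> 'o"
  Cod :: "'m \<Rightarrow> 'o"
  Idn :: "'o \<Rightarrow> 'm"
  Comp :: "'m \<Rightarrow> 'm \<Rightarrow> 'm"  (infixl "\<Zsemi>\<index>" 70)

definition Hom :: "('o, 'm, 'z) cat_scheme \<Rightarrow> 'o \<Rightarrow> 'o \<Rightarrow> 'm set" where
  "Hom C X Y = {f \<in> Arr C. Dom C f = X \<and> Cod C f = Y}"

locale category =
  fixes C :: "('o, 'm, 'z) cat_scheme" (structure)
  assumes Dom_Obj: "f \<in> Arr C \<Longrightarrow> Dom C f \<in> Obj C"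
    and Cod_Obj: "f \<in> Arr C \<Longrightarrow> Cod C f \<in> Obj C"
    and Idn_Hom: "X \<in> Obj C \<Longrightarrow> Idn C X \<in> Hom C X X"
    and Comp_Hom: "f \<in> Hom C X Y \<Longrightarrow> g \<in> Hom C Y Z \<Longrightarrow> f \<Zsemi> g \<in> Hom C X Z"
    and Idn_left: "f \<in> Hom C X Y \<Longrightarrow> Idn C X \<Zsemi> f = f"
    and Idn_right: "f \<in> Hom C X Y \<Longrightarrow> f \<Zsemi> Idn C Y = f"
    and Comp_assoc: "f \<in> Hom C W X \<Longrightarrow> g \<in> Hom C X Y \<Longrightarrow> h \<in> Hom C Y Z \<Longrightarrow>
      (f \<Zsemi> g) \<Zsemi> h = f \<Zsemi> (g \<Zsemi> h)"

definition is_terminal :: "('o, 'm, 'z) cat_scheme \<Rightarrow> 'o \<Rightarrow> bool" where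
  "is_terminal C X \<longleftrightarrow> X \<in> Obj C \<and> (\<forall>Y\<in>Obj C. \<exists>!f. f \<in> Hom C Y X)"

definition is_initial :: "('o, 'm, 'z) cat_scheme \<Rightarrow> 'o \<Rightarrow> bool" where
  "is_initial C X \<longleftrightarrow> X \<in> Obj C \<and> (\<forall>Y\<in>Obj C. \<exists>!f. f \<in> Hom C X Y)"

text \<open>\<open>is_pullback C p q f g\<close>: the span \<open>p, q\<close> is a pullback of the opspan \<open>f, g\<close>,
  with \<open>p \<Zsemi> f = q \<Zsemi> g\<close>.  Dually, \<open>is_pushout C i j f g\<close>: the opspan \<open>i, j\<close> is a
  pushout of the span \<open>f, g\<close>, with \<open>f \<Zsemi> i = g \<Zsemi> j\<close>.\<close>

definition is_pullback ::
    "('o, 'm, 'z) cat_scheme \<Rightarrow> 'm \<Rightarrow> 'm \<Rightarrow> 'm \<Rightarrow> 'm \<Rightarrow> bool" where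
  "is_pullback C p q f g \<longleftrightarrow>
    f \<in> Arr C \<and> g \<in> Arr C \<and> Cod C f = Cod C g \<and>
    p \<in> Hom C (Dom C p) (Dom C f) \<and> q \<in> Hom C (Dom C p) (Dom C g) \<and>
    p \<Zsemi>\<^bsub>C\<^esub> f = q \<Zsemi>\<^bsub>C\<^esub> g \<and>
    (\<forall>W\<in>Obj C. \<forall>h\<in>Hom C W (Dom C f). \<forall>k\<in>Hom C W (Dom C g).
      h \<Zsemi>\<^bsub>C\<^esub> f = k \<Zsemi>\<^bsub>C\<^esub> g \<longrightarrow>
      (\<exists>!m. m \<in> Hom C W (Dom C p) \<and> m \<Zsemi>\<^bsub>C\<^esub> p = h \<and> m \<Zsemi>\<^bsub>C\<^esub> q = k))"

definition is_pushout ::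
    "('o, 'm, 'z) cat_scheme \<Rightarrow> 'm \<Rightarrow> 'm \<Rightarrow> 'm \<Rightarrow> 'm \<Rightarrow> bool" where
  "is_pushout C i j f g \<longleftrightarrow>
    f \<in> Arr C \<and> g \<in> Arr C \<and> Dom C f = Dom C g \<and>
    i \<in> Hom C (Cod C f) (Cod C i) \<and> j \<in> Hom C (Cod C g) (Cod C i) \<and>
    f \<Zsemi>\<^bsub>C\<^esub> i = g \<Zsemi>\<^bsub>C\<^esub> j \<and>
    (\<forall>W\<in>Obj C. \<forall>h\<in>Hom C (Cod C f) W. \<forall>k\<in>Hom C (Cod C g) W.
      f \<Zsemi>\<^bsub>C\<^esub> h = g \<Zsemi>\<^bsub>C\<^esub> k \<longrightarrow>
      (\<exists>!m. m \<in> Hom C (Cod C i) W \<and> i \<Zsemi>\<^bsub>C\<^esub> m = h \<and> j \<Zsemi>\<^bsub>C\<^esub> m = k))"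

definition is_coproduct :: "('o, 'm, 'z) cat_scheme \<Rightarrow> 'm \<Rightarrow> 'm \<Rightarrow> bool" where
  "is_coproduct C i j \<longleftrightarrow>
    i \<in> Arr C \<and> j \<in> Arr C \<and> Cod C i = Cod C j \<and>
    (\<forall>W\<in>Obj C. \<forall>h\<in>Hom C (Dom C i) W. \<forall>k\<in>Hom C (Dom C j) W.
      \<exists>!m. m \<in> Hom C (Cod C i) W \<and> i \<Zsemi>\<^bsub>C\<^esub> m = h \<and> j \<Zsemi>\<^bsub>C\<^esub> m = k)"

definition is_coequalizer :: "('o, 'm, 'z) cat_scheme \<Rightarrow> 'm \<Rightarrow> 'm \<Rightarrow> 'm \<Rightarrow> bool" where
  "is_coequalizer C r s q \<longleftrightarrow>
    r \<in> Arr C \<and> s \<in> Hom C (Dom C r) (Cod C r) \<and> q \<in> Hom C (Cod C r) (Cod C q) \<and>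
    r \<Zsemi>\<^bsub>C\<^esub> q = s \<Zsemi>\<^bsub>C\<^esub> q \<and>
    (\<forall>W\<in>Obj C. \<forall>h\<in>Hom C (Cod C r) W. r \<Zsemi>\<^bsub>C\<^esub> h = s \<Zsemi>\<^bsub>C\<^esub> h \<longrightarrow>
      (\<exists>!m. m \<in> Hom C (Cod C q) W \<and> q \<Zsemi>\<^bsub>C\<^esub> m = h))"

definition is_monic :: "('o, 'm, 'z) cat_scheme \<Rightarrow> 'm \<Rightarrow> bool" where
  "is_monic C f \<longleftrightarrow> f \<in> Arr C \<and>
    (\<forall>W\<in>Obj C. \<forall>h\<in>Hom C W (Dom C f). \<forall>k\<in>Hom C W (Dom C f).
      h \<Zsemi>\<^bsub>C\<^esub> f = k \<Zsemi>\<^bsub>C\<^esub> f \<longrightarrow> h = k)"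

definition is_equivalence_relation :: "('o, 'm, 'z) cat_scheme \<Rightarrow> 'm \<Rightarrow> 'm \<Rightarrow> bool" where
  "is_equivalence_relation C r s \<longleftrightarrow>
    r \<in> Arr C \<and> s \<in> Hom C (Dom C r) (Cod C r) \<and>
    \<comment> \<open>jointly monic\<close>
    (\<forall>W\<in>Obj C. \<forall>h\<in>Hom C W (Dom C r). \<forall>k\<in>Hom C W (Dom C r).
      h \<Zsemi>\<^bsub>C\<^esub> r = k \<Zsemi>\<^bsub>C\<^esub> r \<and> h \<Zsemi>\<^bsub>C\<^esub> s = k \<Zsemi>\<^bsub>C\<^esub> s \<longrightarrow> h = k) \<and>
    \<comment> \<open>reflexive\<close>
    (\<exists>d\<in>Hom C (Cod C r) (Dom C r).
      d \<Zsemi>\<^bsub>C\<^esub> r = Idn C (Cod C r) \<and> d \<Zsemi>\<^bsub>C\<^esub> s = Idn C (Cod C r)) \<and>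
    \<comment> \<open>symmetric\<close>
    (\<exists>t\<in>Hom C (Dom C r) (Dom C r). t \<Zsemi>\<^bsub>C\<^esub> r = s \<and> t \<Zsemi>\<^bsub>C\<^esub> s = r) \<and>
    \<comment> \<open>transitive\<close>
    (\<forall>p q. is_pullback C p q s r \<longrightarrow>
      (\<exists>m\<in>Hom C (Dom C p) (Dom C r). m \<Zsemi>\<^bsub>C\<^esub> r = p \<Zsemi>\<^bsub>C\<^esub> r \<and> m \<Zsemi>\<^bsub>C\<^esub> s = q \<Zsemi>\<^bsub>C\<^esub> s))"

text \<open>A coequalizer diagram \<open>r, s : R \<rightarrow> X\<close>, \<open>q : X \<rightarrow> Q\<close> is stable if pulling the
  whole diagram back along any \<open>f : Y \<rightarrow> Q\<close> gives a coequalizer diagram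
  \<open>r', s' : R' \<rightarrow> X'\<close>, \<open>q' : X' \<rightarrow> Y\<close>.\<close>

definition is_stable_coequalizer :: "('o, 'm, 'z) cat_scheme \<Rightarrow> 'm \<Rightarrow> 'm \<Rightarrow> 'm \<Rightarrow> bool" where
  "is_stable_coequalizer C r s q \<longleftrightarrow>
    is_coequalizer C r s q \<and>
    (\<forall>f g q' h k r' s'.
      is_pullback C g q' q f \<and> is_pullback C h k (r \<Zsemi>\<^bsub>C\<^esub> q) f \<and>
      r' \<in> Hom C (Dom C h) (Dom C g) \<and> r' \<Zsemi>\<^bsub>C\<^esub> g = h \<Zsemi>\<^bsub>C\<^esub> r \<and> r' \<Zsemi>\<^bsub>C\<^esub> q' = k \<and>
      s' \<in> Hom C (Dom C h) (Dom C g) \<and> s' \<Zsemi>\<^bsub>C\<^esub> g = h \<Zsemi>\<^bsub>C\<^esub> s \<and> s' \<Zsemi>\<^bsub>C\<^esub> q' = k \<longrightarrow>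
      is_coequalizer C r' s' q')"

locale pretopos = category +
  assumes ex_terminal: "\<exists>X. is_terminal C X"
    and ex_pullback: "f \<in> Arr C \<Longrightarrow> g \<in> Arr C \<Longrightarrow> Cod C f = Cod C g \<Longrightarrow>
      \<exists>p q. is_pullback C p q f g"
    and ex_initial: "\<exists>X. is_initial C X"
    and ex_coproduct: "X \<in> Obj C \<Longrightarrow> Y \<in> Obj C \<Longrightarrow>
      \<exists>i j. is_coproduct C i j \<and> Dom C i = X \<and> Dom C j = Y"
    \<comment> \<open>The pullback along \<open>f\<close> of the empty coproduct cocone on \<open>Cod f\<close> is the empty
      cocone on \<open>Dom f\<close>.\<close>
    and initial_stable: "is_initial C (Cod C f) \<Longrightarrow> f \<in> Arr C \<Longrightarrow> is_initial C (Dom C f)"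
    and coproduct_stable: "is_coproduct C i j \<Longrightarrow>
      is_pullback C i' a i f \<Longrightarrow> is_pullback C j' b j f \<Longrightarrow> is_coproduct C a b"
    and coproduct_disjoint: "is_coproduct C i j \<Longrightarrow>
      is_monic C i \<and> is_monic C j \<and> (\<forall>p q. is_pullback C p q i j \<longrightarrow> is_initial C (Dom C p))"
    and stable_effective_quotient: "is_equivalence_relation C r s \<Longrightarrow>
      \<exists>q. is_stable_coequalizer C r s q \<and> is_pullback C r s q q"


section \<open>Arithmetic universes\<close>

record ('o, 'm) au = "('o, 'm) cat" +
  One :: 'o
  Pb1 :: "'m \<Rightarrow> 'm \<Rightarrow> 'm"
  Pb2 :: "'m \<Rightarrow> 'm \<Rightarrow> 'm"
  Zero :: 'o
  Po1 :: "'m \<Rightarrow> 'm \<Rightarrow> 'm"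
  Po2 :: "'m \<Rightarrow> 'm \<Rightarrow> 'm"
  List :: "'o \<Rightarrow> 'o"
  Eps :: "'o \<Rightarrow> 'm"
  Cons :: "'o \<Rightarrow> 'm"

definition to_terminal :: "('o, 'm, 'z) cat_scheme \<Rightarrow> 'o \<Rightarrow> 'o \<Rightarrow> 'm" where
  "to_terminal C T X = (THE f. f \<in> Hom C X T)"

definition Pr1 :: "('o, 'm, 'z) au_scheme \<Rightarrow> 'o \<Rightarrow> 'o \<Rightarrow> 'm" where
  "Pr1 A X Y = Pb1 A (to_terminal A (One A) X) (to_terminal A (One A) Y)"

definition Pr2 :: "('o, 'm, 'z) au_scheme \<Rightarrow> 'o \<Rightarrow> 'o \<Rightarrow> 'm" where
  "Pr2 A X Y = Pb2 A (to_terminal A (One A) X) (to_terminal A (One A) Y)"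

definition Prod :: "('o, 'm, 'z) au_scheme \<Rightarrow> 'o \<Rightarrow> 'o \<Rightarrow> 'o" where
  "Prod A X Y = Dom A (Pr1 A X Y)"

definition Pairing :: "('o, 'm, 'z) au_scheme \<Rightarrow> 'm \<Rightarrow> 'm \<Rightarrow> 'm" where
  "Pairing A f g = (THE h. h \<in> Hom A (Dom A f) (Prod A (Cod A f) (Cod A g)) \<and>
     h \<Zsemi>\<^bsub>A\<^esub> Pr1 A (Cod A f) (Cod A g) = f \<and> h \<Zsemi>\<^bsub>A\<^esub> Pr2 A (Cod A f) (Cod A g) = g)"

text \<open>\<open>is_list_object A T u v p q e c\<close>: here \<open>T\<close> is any terminal object, \<open>p, q\<close> any pullback
  \<open>P\<close> of \<open>u : X \<rightarrow> T \<leftarrow> L : v\<close>, and \<open>e : T \<rightarrow> L\<close>, \<open>c : P \<rightarrow> L\<close> make \<open>L\<close> a parametrized list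
  object for \<open>X\<close>.  The two equations on \<open>r : L \<times> B \<rightarrow> Y\<close> are \<open>r([], b) = y(b)\<close> and
  \<open>r(cons(a, x), b) = g(a, r(x, b))\<close>, the latter as morphisms \<open>P \<times> B \<rightarrow> Y\<close>.\<close>

definition is_list_object ::
    "('o, 'm, 'z) au_scheme \<Rightarrow> 'o \<Rightarrow> 'm \<Rightarrow> 'm \<Rightarrow> 'm \<Rightarrow> 'm \<Rightarrow> 'm \<Rightarrow> 'm \<Rightarrow> bool" where
  "is_list_object A T u v p q e c \<longleftrightarrow>
    (let X = Dom A u; L = Dom A v; P = Dom A p in
      is_terminal A T \<and> Cod A u = T \<and> is_pullback A p q u v \<and>
      e \<in> Hom A T L \<and> c \<in> Hom A P L \<and>
      (\<forall>B\<in>Obj A. \<forall>Y\<in>Obj A. \<forall>y\<in>Hom A B Y. \<forall>g\<in>Hom A (Prod A X Y) Y.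
        \<exists>!r. r \<in> Hom A (Prod A L B) Y \<and>
          Pairing A (to_terminal A T B \<Zsemi>\<^bsub>A\<^esub> e) (Idn A B) \<Zsemi>\<^bsub>A\<^esub> r = y \<and>
          Pairing A (Pr1 A P B \<Zsemi>\<^bsub>A\<^esub> c) (Pr2 A P B) \<Zsemi>\<^bsub>A\<^esub> r =
          Pairing A (Pr1 A P B \<Zsemi>\<^bsub>A\<^esub> p)
            (Pairing A (Pr1 A P B \<Zsemi>\<^bsub>A\<^esub> q) (Pr2 A P B) \<Zsemi>\<^bsub>A\<^esub> r) \<Zsemi>\<^bsub>A\<^esub> g))"

locale arithmetic_universe = pretopos A
  for A :: "('o, 'm) au" (structure) +
  assumes One_terminal: "is_terminal A (One A)"
    and Pb_pullback: "f \<in> Arr A \<Longrightarrow> g \<in> Arr A \<Longrightarrow> Cod A f = Cod A g \<Longrightarrow>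
      is_pullback A (Pb1 A f g) (Pb2 A f g) f g"
    and Zero_initial: "is_initial A (Zero A)"
    and Po_pushout: "f \<in> Arr A \<Longrightarrow> g \<in> Arr A \<Longrightarrow> Dom A f = Dom A g \<Longrightarrow>
      is_pushout A (Po1 A f g) (Po2 A f g) f g"
    and List_Obj: "X \<in> Obj A \<Longrightarrow> List A X \<in> Obj A"
    and List_list_object: "X \<in> Obj A \<Longrightarrow>
      is_list_object A (One A)
        (to_terminal A (One A) X) (to_terminal A (One A) (List A X))
        (Pr1 A X (List A X)) (Pr2 A X (List A X)) (Eps A X) (Cons A X)"


section \<open>Sketches\<close>

text \<open>A commutativity \<open>k\<close> has the triangle
  \<open>fst_edge k, snd_edge k \<sim> comp_edge k\<close>.\<close>

record ('n, 'e, 'u) sketch =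
  nodes :: "'n set"
  edges :: "'e set"
  comms :: "'u set"
  terminals :: "'u set"
  pullbacks :: "'u set"
  initials :: "'u set"
  pushouts :: "'u set"
  lists :: "'u set"
  src :: "'e \<Rightarrow> 'n"
  tgt :: "'e \<Rightarrow> 'n"
  ident :: "'n \<Rightarrow> 'e"
  fst_edge :: "'u \<Rightarrow> 'e"
  snd_edge :: "'u \<Rightarrow> 'e"
  comp_edge :: "'u \<Rightarrow> 'e"
  terminal_node :: "'u \<Rightarrow> 'n"
  pb_comm1 :: "'u \<Rightarrow> 'u"
  pb_comm2 :: "'u \<Rightarrow> 'u"
  initial_node :: "'u \<Rightarrow> 'n"
  po_comm1 :: "'u \<Rightarrow> 'u"
  po_comm2 :: "'u \<Rightarrow> 'u"
  list_terminal :: "'u \<Rightarrow> 'u"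
  list_pullback :: "'u \<Rightarrow> 'u"
  list_eps :: "'u \<Rightarrow> 'e"
  list_cons :: "'u \<Rightarrow> 'e"

text \<open>A pullback universal has commutativities \<open>p\<^sup>1 u\<^sub>1 \<sim> p\<close> and \<open>p\<^sup>2 u\<^sub>2 \<sim> p\<close>;
  a pushout universal has commutativities \<open>u\<^sub>1 q\<^sup>1 \<sim> q\<close> and \<open>u\<^sub>2 q\<^sup>2 \<sim> q\<close>.\<close>

abbreviation pb_proj1 where "pb_proj1 S w \<equiv> fst_edge S (pb_comm1 S w)"
abbreviation pb_proj2 where "pb_proj2 S w \<equiv> fst_edge S (pb_comm2 S w)"
abbreviation pb_leg1 where "pb_leg1 S w \<equiv> snd_edge S (pb_comm1 S w)"
abbreviation pb_leg2 where "pb_leg2 S w \<equiv> snd_edge S (pb_comm2 S w)"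
abbreviation pb_diag where "pb_diag S w \<equiv> comp_edge S (pb_comm1 S w)"
abbreviation pb_node where "pb_node S w \<equiv> src S (pb_diag S w)"

abbreviation po_leg1 where "po_leg1 S w \<equiv> fst_edge S (po_comm1 S w)"
abbreviation po_leg2 where "po_leg2 S w \<equiv> fst_edge S (po_comm2 S w)"
abbreviation po_inj1 where "po_inj1 S w \<equiv> snd_edge S (po_comm1 S w)"
abbreviation po_inj2 where "po_inj2 S w \<equiv> snd_edge S (po_comm2 S w)"
abbreviation po_diag where "po_diag S w \<equiv> comp_edge S (po_comm1 S w)"
abbreviation po_node where "po_node S w \<equiv> tgt S (po_diag S w)"

abbreviation list_arg where "list_arg S l \<equiv> src S (pb_leg1 S (list_pullback S l))"
abbreviation list_node where "list_node S l \<equiv> src S (pb_leg2 S (list_pullback S l))"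

definition is_sketch :: "('n, 'e, 'u) sketch \<Rightarrow> bool" where
  "is_sketch S \<longleftrightarrow>
    (\<forall>f\<in>edges S. src S f \<in> nodes S \<and> tgt S f \<in> nodes S) \<and>
    (\<forall>X\<in>nodes S. ident S X \<in> edges S \<and> src S (ident S X) = X \<and> tgt S (ident S X) = X) \<and>
    (\<forall>k\<in>comms S.
      fst_edge S k \<in> edges S \<and> snd_edge S k \<in> edges S \<and> comp_edge S k \<in> edges S \<and>
      tgt S (fst_edge S k) = src S (snd_edge S k) \<and>
      src S (comp_edge S k) = src S (fst_edge S k) \<and>
      tgt S (comp_edge S k) = tgt S (snd_edge S k)) \<and>
    (\<forall>t\<in>terminals S. terminal_node S t \<in> nodes S) \<and>
    (\<forall>t\<in>initials S. initial_node S t \<in> nodes S) \<and>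
    (\<forall>w\<in>pullbacks S. pb_comm1 S w \<in> comms S \<and> pb_comm2 S w \<in> comms S \<and>
      comp_edge S (pb_comm1 S w) = comp_edge S (pb_comm2 S w)) \<and>
    (\<forall>w\<in>pushouts S. po_comm1 S w \<in> comms S \<and> po_comm2 S w \<in> comms S \<and>
      comp_edge S (po_comm1 S w) = comp_edge S (po_comm2 S w)) \<and>
    (\<forall>l\<in>lists S.
      list_terminal S l \<in> terminals S \<and> list_pullback S l \<in> pullbacks S \<and>
      tgt S (pb_leg1 S (list_pullback S l)) = terminal_node S (list_terminal S l) \<and>
      list_eps S l \<in> edges S \<and>
      src S (list_eps S l) = terminal_node S (list_terminal S l) \<and>
      tgt S (list_eps S l) = list_node S l \<and>
      list_cons S l \<in> edges S \<and>
      src S (list_cons S l) = pb_node S (list_pullback S l) \<and>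
      tgt S (list_cons S l) = list_node S l)"


section \<open>Extensions and contexts\<close>

definition subsketch :: "('n, 'e, 'u) sketch \<Rightarrow> ('n, 'e, 'u) sketch \<Rightarrow> bool" where
  "subsketch U V \<longleftrightarrow>
    is_sketch U \<and> is_sketch V \<and>
    nodes U \<subseteq> nodes V \<and> edges U \<subseteq> edges V \<and> comms U \<subseteq> comms V \<and>
    terminals U \<subseteq> terminals V \<and> pullbacks U \<subseteq> pullbacks V \<and>
    initials U \<subseteq> initials V \<and> pushouts U \<subseteq> pushouts V \<and> lists U \<subseteq> lists V \<and>
    (\<forall>f\<in>edges U. src V f = src U f \<and> tgt V f = tgt U f) \<and>
    (\<forall>X\<in>nodes U. ident V X = ident U X) \<and>
    (\<forall>k\<in>comms U. fst_edge V k = fst_edge U k \<and> snd_edge V k = snd_edge U k \<and>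
      comp_edge V k = comp_edge U k) \<and>
    (\<forall>t\<in>terminals U. terminal_node V t = terminal_node U t) \<and>
    (\<forall>w\<in>pullbacks U. pb_comm1 V w = pb_comm1 U w \<and> pb_comm2 V w = pb_comm2 U w) \<and>
    (\<forall>t\<in>initials U. initial_node V t = initial_node U t) \<and>
    (\<forall>w\<in>pushouts U. po_comm1 V w = po_comm1 U w \<and> po_comm2 V w = po_comm2 U w) \<and>
    (\<forall>l\<in>lists U. list_terminal V l = list_terminal U l \<and>
      list_pullback V l = list_pullback U l \<and>
      list_eps V l = list_eps U l \<and> list_cons V l = list_cons U l)"

definition adjoins :: "'a set \<Rightarrow> 'a list \<Rightarrow> 'a set \<Rightarrow> bool" where
  "adjoins X xs Y \<longleftrightarrow> distinct xs \<and> set xs \<inter> X = {} \<and> Y = X \<union> set xs"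

text \<open>\<open>extends_by U V ns es ks ts ws is qs ls\<close>: the sketch \<open>V\<close> is obtained from \<open>U\<close> by adjoining
  exactly the listed fresh, pairwise distinct nodes, edges, commutativities, and terminal,
  pullback, initial, pushout and list universals.\<close>

definition extends_by ::
    "('n, 'e, 'u) sketch \<Rightarrow> ('n, 'e, 'u) sketch \<Rightarrow> 'n list \<Rightarrow> 'e list \<Rightarrow> 'u list \<Rightarrow>
     'u list \<Rightarrow> 'u list \<Rightarrow> 'u list \<Rightarrow> 'u list \<Rightarrow> 'u list \<Rightarrow> bool" where
  "extends_by U V ns es ks ts ws is qs ls \<longleftrightarrow>
    subsketch U V \<and>
    adjoins (nodes U) ns (nodes V) \<and> adjoins (edges U) es (edges V) \<and>
    adjoins (comms U) ks (comms V) \<and> adjoins (terminals U) ts (terminals V) \<and>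
    adjoins (pullbacks U) ws (pullbacks V) \<and> adjoins (initials U) is (initials V) \<and>
    adjoins (pushouts U) qs (pushouts V) \<and> adjoins (lists U) ls (lists V)"

text \<open>Membership of sources, targets and triangles in the smaller sketch is forced by \<open>V\<close> being
  a sketch in those rules where it is not assumed.\<close>

inductive simple_extension :: "('n, 'e, 'u) sketch \<Rightarrow> ('n, 'e, 'u) sketch \<Rightarrow> bool"
  for U V :: "('n, 'e, 'u) sketch" where
  primitive_node:
    "extends_by U V [X] [ident V X] [] [] [] [] [] [] \<Longrightarrow> simple_extension U V"
| primitive_edge:
    "extends_by U V [] [f] [] [] [] [] [] [] \<Longrightarrow> simple_extension U V"
| commutativity:
    "extends_by U V [] [] [k] [] [] [] [] [] \<Longrightarrow> simple_extension U V"
| terminal_universal: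
    "extends_by U V [X] [ident V X] [] [t] [] [] [] [] \<Longrightarrow> terminal_node V t = X \<Longrightarrow>
     simple_extension U V"
| initial_universal:
    "extends_by U V [X] [ident V X] [] [] [] [t] [] [] \<Longrightarrow> initial_node V t = X \<Longrightarrow>
     simple_extension U V"
| pullback_universal:
    "extends_by U V [P] [ident V P, pb_proj1 V w, pb_proj2 V w, pb_diag V w]
       [pb_comm1 V w, pb_comm2 V w] [] [w] [] [] [] \<Longrightarrow>
     pb_node V w = P \<Longrightarrow> pb_leg1 V w \<in> edges U \<Longrightarrow> pb_leg2 V w \<in> edges U \<Longrightarrow>
     simple_extension U V"
| pushout_universal:
    "extends_by U V [Q] [ident V Q, po_inj1 V w, po_inj2 V w, po_diag V w]
       [po_comm1 V w, po_comm2 V w] [] [] [] [w] [] \<Longrightarrow>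
     po_node V w = Q \<Longrightarrow> po_leg1 V w \<in> edges U \<Longrightarrow> po_leg2 V w \<in> edges U \<Longrightarrow>
     simple_extension U V"
| list_universal:
    "extends_by U V [T, L, P]
       [ident V T, ident V L, ident V P, list_eps V l, list_cons V l,
        pb_proj1 V w, pb_proj2 V w, pb_diag V w, pb_leg1 V w, pb_leg2 V w]
       [pb_comm1 V w, pb_comm2 V w] [t] [w] [] [] [l] \<Longrightarrow>
     list_terminal V l = t \<Longrightarrow> list_pullback V l = w \<Longrightarrow>
     terminal_node V t = T \<Longrightarrow> list_node V l = L \<Longrightarrow> pb_node V w = P \<Longrightarrow>
     list_arg V l \<in> nodes U \<Longrightarrow>
     simple_extension U V"

definition extension :: "('n, 'e, 'u) sketch \<Rightarrow> ('n, 'e, 'u) sketch \<Rightarrow> bool" where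
  "extension = simple_extension\<^sup>*\<^sup>*"

definition empty_sketch :: "('n, 'e, 'u) sketch \<Rightarrow> bool" where
  "empty_sketch S \<longleftrightarrow> nodes S = {} \<and> edges S = {} \<and> comms S = {} \<and> terminals S = {} \<and>
    pullbacks S = {} \<and> initials S = {} \<and> pushouts S = {} \<and> lists S = {}"

definition is_context :: "('n, 'e, 'u) sketch \<Rightarrow> bool" where
  "is_context T \<longleftrightarrow> (\<exists>E. empty_sketch E \<and> extension E T)"

text \<open>In a context, each simple extension step that adjoins nodes either adjoins a primitive node,
  or adjoins fresh nodes together with universals of which they are nodes.  So the nodes
  adjoined as primitive nodes are exactly those that are not a node of any universal, whichever
  way the context is built up; the nodes \<open>T\<close> and \<open>P\<close> of a list universal are nodes of
  its terminal and pullback universals.\<close>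

definition primitive_nodes :: "('n, 'e, 'u) sketch \<Rightarrow> 'n set" where
  "primitive_nodes S = nodes S -
    (terminal_node S ` terminals S \<union> initial_node S ` initials S \<union>
     pb_node S ` pullbacks S \<union> po_node S ` pushouts S \<union> list_node S ` lists S)"


section \<open>Models\<close>

text \<open>Interpretations of nodes and edges, and families of carriers, are extensional functions, so
  that HOL equality is equality of the functions on the nodes and edges of the sketch.\<close>

record ('n, 'e, 'o, 'm) interp =
  node_map :: "'n \<Rightarrow> 'o"
  edge_map :: "'e \<Rightarrow> 'm"

definition interpretation_of ::
    "('n, 'e, 'u) sketch \<Rightarrow> ('o, 'm) au \<Rightarrow> ('n, 'e, 'o, 'm) interp \<Rightarrow> bool" where
  "interpretation_of S A M \<longleftrightarrow>
    node_map M \<in> nodes S \<rightarrow>\<^sub>E Obj A \<and>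
    edge_map M \<in> (\<Pi>\<^sub>E f\<in>edges S. Hom A (node_map M (src S f)) (node_map M (tgt S f))) \<and>
    (\<forall>X\<in>nodes S. edge_map M (ident S X) = Idn A (node_map M X)) \<and>
    (\<forall>k\<in>comms S. edge_map M (fst_edge S k) \<Zsemi>\<^bsub>A\<^esub> edge_map M (snd_edge S k) =
      edge_map M (comp_edge S k))"

definition model ::
    "('n, 'e, 'u) sketch \<Rightarrow> ('o, 'm) au \<Rightarrow> ('n, 'e, 'o, 'm) interp \<Rightarrow> bool" where
  "model S A M \<longleftrightarrow>
    interpretation_of S A M \<and>
    (\<forall>t\<in>terminals S. is_terminal A (node_map M (terminal_node S t))) \<and>
    (\<forall>t\<in>initials S. is_initial A (node_map M (initial_node S t))) \<and>
    (\<forall>w\<in>pullbacks S.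
      is_pullback A (edge_map M (pb_proj1 S w)) (edge_map M (pb_proj2 S w))
        (edge_map M (pb_leg1 S w)) (edge_map M (pb_leg2 S w))) \<and>
    (\<forall>w\<in>pushouts S.
      is_pushout A (edge_map M (po_inj1 S w)) (edge_map M (po_inj2 S w))
        (edge_map M (po_leg1 S w)) (edge_map M (po_leg2 S w))) \<and>
    (\<forall>l\<in>lists S.
      let w = list_pullback S l in
      is_list_object A (node_map M (terminal_node S (list_terminal S l)))
        (edge_map M (pb_leg1 S w)) (edge_map M (pb_leg2 S w))
        (edge_map M (pb_proj1 S w)) (edge_map M (pb_proj2 S w))
        (edge_map M (list_eps S l)) (edge_map M (list_cons S l)))"

text \<open>For a list universal, the terminal and pullback universals it comprises are interpreted
  canonically by the clauses for terminal and pullback universals.\<close>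

definition strict_model ::
    "('n, 'e, 'u) sketch \<Rightarrow> ('o, 'm) au \<Rightarrow> ('n, 'e, 'o, 'm) interp \<Rightarrow> bool" where
  "strict_model S A M \<longleftrightarrow>
    interpretation_of S A M \<and>
    (\<forall>t\<in>terminals S. node_map M (terminal_node S t) = One A) \<and>
    (\<forall>t\<in>initials S. node_map M (initial_node S t) = Zero A) \<and>
    (\<forall>w\<in>pullbacks S.
      edge_map M (pb_proj1 S w) =
        Pb1 A (edge_map M (pb_leg1 S w)) (edge_map M (pb_leg2 S w)) \<and>
      edge_map M (pb_proj2 S w) =
        Pb2 A (edge_map M (pb_leg1 S w)) (edge_map M (pb_leg2 S w))) \<and>
    (\<forall>w\<in>pushouts S.
      edge_map M (po_inj1 S w) =
        Po1 A (edge_map M (po_leg1 S w)) (edge_map M (po_leg2 S w)) \<and>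
      edge_map M (po_inj2 S w) =
        Po2 A (edge_map M (po_leg1 S w)) (edge_map M (po_leg2 S w))) \<and>
    (\<forall>l\<in>lists S.
      node_map M (list_node S l) = List A (node_map M (list_arg S l)) \<and>
      edge_map M (list_eps S l) = Eps A (node_map M (list_arg S l)) \<and>
      edge_map M (list_cons S l) = Cons A (node_map M (list_arg S l)))"

definition model_hom ::
    "('n, 'e, 'u) sketch \<Rightarrow> ('o, 'm) au \<Rightarrow> ('n, 'e, 'o, 'm) interp \<Rightarrow>
     ('n, 'e, 'o, 'm) interp \<Rightarrow> ('n \<Rightarrow> 'm) \<Rightarrow> bool" where
  "model_hom S A M N \<phi> \<longleftrightarrow>
    \<phi> \<in> (\<Pi>\<^sub>E X\<in>nodes S. Hom A (node_map M X) (node_map N X)) \<and>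
    (\<forall>f\<in>edges S. edge_map M f \<Zsemi>\<^bsub>A\<^esub> \<phi> (tgt S f) = \<phi> (src S f) \<Zsemi>\<^bsub>A\<^esub> edge_map N f)"

definition model_iso ::
    "('n, 'e, 'u) sketch \<Rightarrow> ('o, 'm) au \<Rightarrow> ('n, 'e, 'o, 'm) interp \<Rightarrow>
     ('n, 'e, 'o, 'm) interp \<Rightarrow> ('n \<Rightarrow> 'm) \<Rightarrow> bool" where
  "model_iso S A M N \<phi> \<longleftrightarrow>
    model_hom S A M N \<phi> \<and>
    (\<exists>\<psi>. model_hom S A N M \<psi> \<and>
      (\<forall>X\<in>nodes S. \<phi> X \<Zsemi>\<^bsub>A\<^esub> \<psi> X = Idn A (node_map M X) \<and>
        \<psi> X \<Zsemi>\<^bsub>A\<^esub> \<phi> X = Idn A (node_map N X)))"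

end

theory Submission
  imports Defs
begin

text \<open>A strict model \<open>M0\<close> together with an isomorphism \<open>\<phi> : M0 \<cong> M1\<close> is determined by \<open>\<phi>\<close> alone.
  Indeed \<open>M0\<close> interprets a node by the domain of the component of \<open>\<phi>\<close> at it, and naturality forces
  it to interpret an edge \<open>f : X \<rightarrow> Y\<close> by the conjugate \<open>\<phi> X \<Zsemi> M1 f \<Zsemi> (\<phi> Y)\<^sup>-\<^sup>1\<close>.  Conversely, every
  family of isomorphisms onto the carriers of \<open>M1\<close> transports \<open>M1\<close> to an interpretation isomorphic
  to it, in which identities and commutativities hold automatically.  So the strict models
  isomorphic to \<open>M1\<close>, with their isomorphisms, correspond to the families whose transport is strict
  (lemma \<open>strict_model_iso_iff\<close>); these are said to straighten \<open>M1\<close>.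

  In a context, each universal is adjoined together with its nodes, so a straightening family can be
  built, and is determined, one simple extension at a time.  A primitive node imposes no
  condition on its component, and the identity may be taken there; this is why uniqueness
  requires the components at primitive nodes to be prescribed.  Primitive edges and commutativities
  have no new nodes, hence no new component.  At the nodes of a universal, strictness has
  exactly one solution: universal objects are unique up to a unique isomorphism that is compatible
  with the isomorphisms already chosen on the data of the universal (lemmas \<open>terminal_ex1_iso\<close>,
  \<open>initial_ex1_iso\<close>, \<open>pullback_ex1_iso\<close>, \<open>pushout_ex1_iso\<close> and \<open>list_straightening_iff\<close>).

  The list object is the only case with work behind it.  The comparison of two list objects
  over isomorphic objects of entries is defined by recursion (lemma \<open>list_fold\<close>), and comparing in both
  directions gives mutually inverse maps because the composites and the identities solve the
  same recursion problem.\<close>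


section \<open>Isomorphisms\<close>

context category
begin

lemma comp_closed [simp]:
  assumes "f \<in> Arr C" "g \<in> Arr C" "Cod C f = Dom C g"
  shows "f \<Zsemi> g \<in> Arr C" "Dom C (f \<Zsemi> g) = Dom C f" "Cod C (f \<Zsemi> g) = Cod C g"
  using Comp_Hom[of f "Dom C f" "Dom C g" g "Cod C g"] assms by (auto simp: Hom_def)

lemma idn_closed [simp]:
  assumes "X \<in> Obj C"
  shows "Idn C X \<in> Arr C" "Dom C (Idn C X) = X" "Cod C (Idn C X) = X"
  using Idn_Hom[OF assms] by (auto simp: Hom_def)

lemma idn_comp [simp]: "f \<in> Arr C \<Longrightarrow> Dom C f = X \<Longrightarrow> Idn C X \<Zsemi> f = f"
  using Idn_left[of f X "Cod C f"] by (auto simp: Hom_def)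

lemma comp_idn [simp]: "f \<in> Arr C \<Longrightarrow> Cod C f = X \<Longrightarrow> f \<Zsemi> Idn C X = f"
  using Idn_right[of f "Dom C f" X] by (auto simp: Hom_def)

lemma comp_assoc [simp]:
  "f \<in> Arr C \<Longrightarrow> g \<in> Arr C \<Longrightarrow> h \<in> Arr C \<Longrightarrow> Cod C f = Dom C g \<Longrightarrow> Cod C g = Dom C h \<Longrightarrow>
    (f \<Zsemi> g) \<Zsemi> h = f \<Zsemi> (g \<Zsemi> h)"
  using Comp_assoc[of f "Dom C f" "Dom C g" g "Dom C h" h "Cod C h"] by (auto simp: Hom_def)

lemma dom_cod_obj [simp]: "f \<in> Arr C \<Longrightarrow> Dom C f \<in> Obj C" "f \<in> Arr C \<Longrightarrow> Cod C f \<in> Obj C"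
  by (simp_all add: Dom_Obj Cod_Obj)

end

definition are_inverse :: "('o, 'm, 'z) cat_scheme \<Rightarrow> 'm \<Rightarrow> 'm \<Rightarrow> bool" where
  "are_inverse C f g \<longleftrightarrow> f \<in> Arr C \<and> g \<in> Hom C (Cod C f) (Dom C f) \<and>
    f \<Zsemi>\<^bsub>C\<^esub> g = Idn C (Dom C f) \<and> g \<Zsemi>\<^bsub>C\<^esub> f = Idn C (Cod C f)"

definition is_iso :: "('o, 'm, 'z) cat_scheme \<Rightarrow> 'm \<Rightarrow> bool" where
  "is_iso C f \<longleftrightarrow> (\<exists>g. are_inverse C f g)"

definition inv_arr :: "('o, 'm, 'z) cat_scheme \<Rightarrow> 'm \<Rightarrow> 'm" where
  "inv_arr C f = (THE g. are_inverse C f g)"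

context category
begin

lemma inverse_unique: "are_inverse C f g \<Longrightarrow> are_inverse C f h \<Longrightarrow> g = h"
proof -
  assume g: "are_inverse C f g" and h: "are_inverse C f h"
  have "g = g \<Zsemi> (f \<Zsemi> h)" using g h by (simp add: are_inverse_def Hom_def)
  also have "\<dots> = (g \<Zsemi> f) \<Zsemi> h" using g h by (subst comp_assoc) (simp_all add: are_inverse_def Hom_def)
  also have "\<dots> = h" using g h by (simp add: are_inverse_def Hom_def)
  finally show "g = h" .
qed

lemma inv_arr_eq: "are_inverse C f g \<Longrightarrow> inv_arr C f = g"
  unfolding inv_arr_def using inverse_unique by blast

lemma iso_inverse: "is_iso C f \<Longrightarrow> are_inverse C f (inv_arr C f)"
  using inv_arr_eq by (auto simp: is_iso_def)

lemma iso_simps [simp]: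
  assumes "is_iso C f"
  shows "f \<in> Arr C" "inv_arr C f \<in> Arr C" "Dom C (inv_arr C f) = Cod C f"
    "Cod C (inv_arr C f) = Dom C f" "f \<Zsemi> inv_arr C f = Idn C (Dom C f)"
    "inv_arr C f \<Zsemi> f = Idn C (Cod C f)"
  using iso_inverse[OF assms] by (auto simp: are_inverse_def Hom_def)

lemma iso_cancel [simp]:
  assumes "is_iso C f" "x \<in> Arr C"
  shows "Dom C x = Dom C f \<Longrightarrow> f \<Zsemi> (inv_arr C f \<Zsemi> x) = x"
    "Dom C x = Cod C f \<Longrightarrow> inv_arr C f \<Zsemi> (f \<Zsemi> x) = x"
  using assms by (simp_all flip: comp_assoc)

lemma iso_inv [simp]: "is_iso C f \<Longrightarrow> is_iso C (inv_arr C f)"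
  "is_iso C f \<Longrightarrow> inv_arr C (inv_arr C f) = f"
proof -
  assume "is_iso C f"
  then have *: "are_inverse C (inv_arr C f) f" by (simp add: are_inverse_def Hom_def)
  then show "is_iso C (inv_arr C f)" by (auto simp: is_iso_def)
  show "inv_arr C (inv_arr C f) = f" using * by (rule inv_arr_eq)
qed

lemma iso_idn [simp]: "X \<in> Obj C \<Longrightarrow> is_iso C (Idn C X)"
  unfolding is_iso_def are_inverse_def by (rule exI[of _ "Idn C X"]) (simp add: Hom_def)

lemma comp_inv_eq_iff:
  assumes "is_iso C a" "f \<in> Arr C" "g \<in> Arr C" "Cod C f = Cod C a" "Cod C g = Dom C a"
  shows "f \<Zsemi> inv_arr C a = g \<longleftrightarrow> f = g \<Zsemi> a"
  using assms by auto


section \<open>Universal objects are determined up to unique isomorphism\<close>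

lemma terminal_unique:
  "is_terminal C T \<Longrightarrow> f \<in> Hom C X T \<Longrightarrow> g \<in> Hom C X T \<Longrightarrow> f = g"
  unfolding is_terminal_def Hom_def by (auto dest: Dom_Obj)

lemma to_terminal_Hom: "is_terminal C T \<Longrightarrow> X \<in> Obj C \<Longrightarrow> to_terminal C T X \<in> Hom C X T"
  unfolding is_terminal_def to_terminal_def by (metis theI')

lemma terminal_ex1_iso:
  assumes "is_terminal C T" "is_terminal C T'"
  shows "\<exists>!\<phi>. is_iso C \<phi> \<and> Dom C \<phi> = T \<and> Cod C \<phi> = T'"
proof -
  have obj: "T \<in> Obj C" "T' \<in> Obj C" using assms by (auto simp: is_terminal_def)
  note f = to_terminal_Hom[OF assms(2) obj(1)] and g = to_terminal_Hom[OF assms(1) obj(2)]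
  have "are_inverse C (to_terminal C T' T) (to_terminal C T T')"
    using f g obj terminal_unique[OF assms(1), of _ T] terminal_unique[OF assms(2), of _ T']
    by (simp add: are_inverse_def Hom_def)
  moreover have "\<phi> = to_terminal C T' T" if "is_iso C \<phi> \<and> Dom C \<phi> = T \<and> Cod C \<phi> = T'" for \<phi>
    using that f by (intro terminal_unique[OF assms(2), of _ T]) (simp_all add: Hom_def)
  moreover have "Dom C (to_terminal C T' T) = T" "Cod C (to_terminal C T' T) = T'"
    using f by (simp_all add: Hom_def)
  ultimately show ?thesis
    by (intro ex1I[of _ "to_terminal C T' T"]) (simp_all add: is_iso_def exI)
qed

lemma pullback_factor:
  assumes "is_pullback C p q f g" "h \<in> Arr C" "k \<in> Arr C" "Dom C h = Dom C k"
    "Cod C h = Dom C f" "Cod C k = Dom C g" "h \<Zsemi> f = k \<Zsemi> g"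
  obtains m where "m \<in> Hom C (Dom C h) (Dom C p)" "m \<Zsemi> p = h" "m \<Zsemi> q = k"
  proof -
  have "h \<in> Hom C (Dom C h) (Dom C f)" "k \<in> Hom C (Dom C h) (Dom C g)"
    using assms by (auto simp: Hom_def)
  then show ?thesis
    using assms that Dom_Obj[of h] unfolding is_pullback_def by metis
qed

lemma pullback_simps:
  assumes "is_pullback C p q f g"
  shows "p \<in> Arr C" "q \<in> Arr C" "f \<in> Arr C" "g \<in> Arr C" "Dom C q = Dom C p"
    "Cod C p = Dom C f" "Cod C q = Dom C g" "Cod C g = Cod C f" "p \<Zsemi> f = q \<Zsemi> g"
  using assms by (auto simp: is_pullback_def Hom_def)

lemma pullback_cancel:
  assumes pb: "is_pullback C p q f g" and "m \<in> Arr C" "m' \<in> Arr C" "Dom C m = Dom C m'"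
    "Cod C m = Dom C p" "Cod C m' = Dom C p" "m \<Zsemi> p = m' \<Zsemi> p" "m \<Zsemi> q = m' \<Zsemi> q"
  shows "m = m'"
proof -
  note s = pullback_simps[OF pb]
  have "(m \<Zsemi> p) \<Zsemi> f = (m \<Zsemi> q) \<Zsemi> g" using assms(2-) s by simp
  moreover have "m \<Zsemi> p \<in> Hom C (Dom C m) (Dom C f)" "m \<Zsemi> q \<in> Hom C (Dom C m) (Dom C g)"
    using assms(2-) s by (auto simp: Hom_def)
  ultimately have "\<exists>!n. n \<in> Hom C (Dom C m) (Dom C p) \<and> n \<Zsemi> p = m \<Zsemi> p \<and> n \<Zsemi> q = m \<Zsemi> q"
    using pb dom_cod_obj(1)[OF assms(2)] unfolding is_pullback_def by blast
  moreover have "m \<in> Hom C (Dom C m) (Dom C p)" "m' \<in> Hom C (Dom C m) (Dom C p)"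
    using assms by (auto simp: Hom_def)
  ultimately show ?thesis using assms by metis
qed

lemma pullback_comparison_iso:
  assumes pb: "is_pullback C p q f g" and pb': "is_pullback C p' q' f g"
    and m: "m \<in> Hom C (Dom C p) (Dom C p')" "m \<Zsemi> p' = p" "m \<Zsemi> q' = q"
  shows "is_iso C m"
proof -
  note s = pullback_simps[OF pb] pullback_simps[OF pb']
  obtain n where n: "n \<in> Hom C (Dom C p') (Dom C p)" "n \<Zsemi> p = p'" "n \<Zsemi> q = q'"
    using pullback_factor[OF pb, of p' q'] s by metis
  have mn: "m \<in> Arr C" "n \<in> Arr C" "Dom C m = Dom C p" "Cod C m = Dom C p'"
    "Dom C n = Dom C p'" "Cod C n = Dom C p"
    using m n by (auto simp: Hom_def)
  have "m \<Zsemi> n = Idn C (Dom C p)"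
    by (rule pullback_cancel[OF pb]) (use m n mn s in auto)
  moreover have "n \<Zsemi> m = Idn C (Dom C p')"
    by (rule pullback_cancel[OF pb']) (use m n mn s in auto)
  ultimately show ?thesis
    unfolding is_iso_def are_inverse_def using mn by (auto simp: Hom_def)
qed

text \<open>An opspan isomorphic to \<open>f', g'\<close> via \<open>a, b, c\<close> has the conjugates of \<open>p', q'\<close> as a
  pullback, and the comparison map from any other pullback \<open>p, q\<close> of it is \<open>\<phi>\<close>.  The equation that
  contains \<open>p\<close> also forces the domain of \<open>\<phi>\<close>.\<close>

lemma pullback_ex1_iso:
  assumes pb': "is_pullback C p' q' f' g'"
    and iso: "is_iso C a" "is_iso C b" "is_iso C c"
    and cod: "Cod C a = Dom C f'" "Cod C b = Dom C g'" "Cod C c = Cod C f'"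
    and pb: "is_pullback C p q (a \<Zsemi> f' \<Zsemi> inv_arr C c) (b \<Zsemi> g' \<Zsemi> inv_arr C c)"
  shows "\<exists>!\<phi>. is_iso C \<phi> \<and> Cod C \<phi> = Dom C p' \<and>
    \<phi> \<Zsemi> p' \<Zsemi> inv_arr C a = p \<and> \<phi> \<Zsemi> q' \<Zsemi> inv_arr C b = q"
proof -
  note s = pullback_simps[OF pb] pullback_simps[OF pb']
  note t = s(10-17) iso cod
  have pbt: "is_pullback C (p' \<Zsemi> inv_arr C a) (q' \<Zsemi> inv_arr C b)
     (a \<Zsemi> f' \<Zsemi> inv_arr C c) (b \<Zsemi> g' \<Zsemi> inv_arr C c)" (is "is_pullback C ?p ?q ?f ?g")
    unfolding is_pullback_def
  proof (intro conjI ballI impI)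
    have "(p' \<Zsemi> f') \<Zsemi> inv_arr C c = (q' \<Zsemi> g') \<Zsemi> inv_arr C c" using s(18) by simp
    then show "?p \<Zsemi> ?f = ?q \<Zsemi> ?g" using t by simp
  next
    fix W h k
    assume W: "W \<in> Obj C" and h: "h \<in> Hom C W (Dom C ?f)" and k: "k \<in> Hom C W (Dom C ?g)"
      and eq: "h \<Zsemi> ?f = k \<Zsemi> ?g"
    have hk: "h \<in> Arr C" "k \<in> Arr C" "Dom C h = W" "Dom C k = W" "Cod C h = Dom C a" "Cod C k = Dom C b"
      using h k t by (auto simp: Hom_def)
    have "(h \<Zsemi> ?f) \<Zsemi> c = (k \<Zsemi> ?g) \<Zsemi> c" using eq by simp
    then have "(h \<Zsemi> a) \<Zsemi> f' = (k \<Zsemi> b) \<Zsemi> g'" using t hk by simp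
    then obtain m where m: "m \<in> Hom C W (Dom C p')" "m \<Zsemi> p' = h \<Zsemi> a" "m \<Zsemi> q' = k \<Zsemi> b"
      using pullback_factor[OF pb', of "h \<Zsemi> a" "k \<Zsemi> b"] t hk by auto
    have mt: "m \<in> Arr C" "Dom C m = W" "Cod C m = Dom C p'" using m by (auto simp: Hom_def)
    show "\<exists>!m. m \<in> Hom C W (Dom C ?p) \<and> m \<Zsemi> ?p = h \<and> m \<Zsemi> ?q = k"
    proof (rule ex1I[of _ m])
      show "m \<in> Hom C W (Dom C ?p) \<and> m \<Zsemi> ?p = h \<and> m \<Zsemi> ?q = k"
        using m mt t hk by (simp add: Hom_def flip: comp_assoc) (simp add: comp_inv_eq_iff)
    next
      fix n assume n: "n \<in> Hom C W (Dom C ?p) \<and> n \<Zsemi> ?p = h \<and> n \<Zsemi> ?q = k"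
      then have nt: "n \<in> Arr C" "Dom C n = W" "Cod C n = Dom C p'" using t by (auto simp: Hom_def)
      have "(n \<Zsemi> ?p) \<Zsemi> a = h \<Zsemi> a" "(n \<Zsemi> ?q) \<Zsemi> b = k \<Zsemi> b" using n by auto
      then have "n \<Zsemi> p' = h \<Zsemi> a" "n \<Zsemi> q' = k \<Zsemi> b" using nt t by auto
      then show "n = m" using m mt nt pullback_cancel[OF pb', of n m] by simp
    qed
  qed (use t in \<open>auto simp: Hom_def\<close>)
  obtain m where m: "m \<in> Hom C (Dom C p) (Dom C ?p)" "m \<Zsemi> ?p = p" "m \<Zsemi> ?q = q"
    using pullback_factor[OF pbt, of p q] s by metis
  have mt: "m \<in> Arr C" "Dom C m = Dom C p" "Cod C m = Dom C p'" using m t by (auto simp: Hom_def)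
  show ?thesis
  proof (rule ex1I[of _ m])
    show "is_iso C m \<and> Cod C m = Dom C p' \<and>
      m \<Zsemi> p' \<Zsemi> inv_arr C a = p \<and> m \<Zsemi> q' \<Zsemi> inv_arr C b = q"
      using pullback_comparison_iso[OF pb pbt m] m mt t by simp
  next
    fix n
    assume n: "is_iso C n \<and> Cod C n = Dom C p' \<and>
      n \<Zsemi> p' \<Zsemi> inv_arr C a = p \<and> n \<Zsemi> q' \<Zsemi> inv_arr C b = q"
    then have n1: "is_iso C n" "Cod C n = Dom C p'"
      and n2: "n \<Zsemi> p' \<Zsemi> inv_arr C a = p" "n \<Zsemi> q' \<Zsemi> inv_arr C b = q" by auto
    have "Dom C n = Dom C (n \<Zsemi> p' \<Zsemi> inv_arr C a)" using n1 t by simp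
    then have nm: "Dom C n = Dom C m" using mt by (simp only: n2)
    have "n \<Zsemi> ?p = p" "n \<Zsemi> ?q = q" using n1 t by (simp_all flip: n2)
    then have "n \<Zsemi> ?p = m \<Zsemi> ?p" "n \<Zsemi> ?q = m \<Zsemi> ?q" by (simp_all only: m)
    then show "n = m" using n1 mt t nm by (intro pullback_cancel[OF pbt, of n m]) simp_all
  qed
qed

end

text \<open>Initial objects and pushouts are terminal objects and pullbacks of the opposite category, which
  spares a second proof for each of them.\<close>

definition op_cat :: "('o, 'm, 'z) cat_scheme \<Rightarrow> ('o, 'm) cat" where
  "op_cat C = \<lparr>Obj = Obj C, Arr = Arr C, Dom = Cod C, Cod = Dom C, Idn = Idn C,
     Comp = (\<lambda>f g. g \<Zsemi>\<^bsub>C\<^esub> f)\<rparr>"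

lemma op_cat_simps [simp]:
  "Obj (op_cat C) = Obj C" "Arr (op_cat C) = Arr C" "Dom (op_cat C) = Cod C"
  "Cod (op_cat C) = Dom C" "Idn (op_cat C) = Idn C" "f \<Zsemi>\<^bsub>op_cat C\<^esub> g = g \<Zsemi>\<^bsub>C\<^esub> f"
  "Hom (op_cat C) X Y = Hom C Y X"
  by (auto simp: op_cat_def Hom_def)

lemma terminal_op [simp]: "is_terminal (op_cat C) X = is_initial C X"
  by (simp add: is_terminal_def is_initial_def)

lemma are_inverse_op [simp]: "are_inverse (op_cat C) f g = are_inverse C f g"
  unfolding are_inverse_def by (simp add: Hom_def conj_ac)

lemma iso_op [simp]: "is_iso (op_cat C) f = is_iso C f"
  by (simp add: is_iso_def)

lemma inv_arr_op [simp]: "inv_arr (op_cat C) f = inv_arr C f"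
  by (simp add: inv_arr_def)

lemma pullback_op [simp]: "is_pullback (op_cat C) i j f g = is_pushout C i j f g"
  by (simp add: is_pullback_def is_pushout_def)

context category
begin

lemma category_op: "category (op_cat C)"
  by unfold_locales (auto simp: Hom_def)

lemma initial_ex1_iso:
  assumes "is_initial C T" "is_initial C T'"
  shows "\<exists>!\<phi>. is_iso C \<phi> \<and> Dom C \<phi> = T \<and> Cod C \<phi> = T'"
  using category.terminal_ex1_iso[OF category_op, of T' T] assms by (simp add: conj_commute)

text \<open>The dual of the statement for pullbacks.  Duality turns \<open>\<phi>\<close> around, so the opposite category
  provides \<open>inv_arr C \<phi>\<close>, and the legs \<open>a, b, c\<close> enter through their inverses.\<close>

lemma pushout_ex1_iso:
  assumes po': "is_pushout C i' j' f' g'"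
    and iso: "is_iso C a" "is_iso C b" "is_iso C c"
    and cod: "Cod C a = Cod C f'" "Cod C b = Cod C g'" "Cod C c = Dom C f'"
    and po: "is_pushout C i j (c \<Zsemi> f' \<Zsemi> inv_arr C a) (c \<Zsemi> g' \<Zsemi> inv_arr C b)"
  shows "\<exists>!\<phi>. is_iso C \<phi> \<and> Cod C \<phi> = Cod C i' \<and>
    a \<Zsemi> i' \<Zsemi> inv_arr C \<phi> = i \<and> b \<Zsemi> j' \<Zsemi> inv_arr C \<phi> = j"
proof -
  have arr: "f' \<in> Arr C" "g' \<in> Arr C" "i' \<in> Arr C" "j' \<in> Arr C" "Dom C i' = Cod C f'"
     "Dom C j' = Cod C g'" "Cod C j' = Cod C i'" "Dom C g' = Dom C f'"
    using po' by (auto simp: is_pushout_def Hom_def)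
  let ?P = "\<lambda>\<phi>. is_iso C \<phi> \<and> Cod C \<phi> = Cod C i' \<and>
    a \<Zsemi> i' \<Zsemi> inv_arr C \<phi> = i \<and> b \<Zsemi> j' \<Zsemi> inv_arr C \<phi> = j"
  have ex1: "\<exists>!\<psi>. is_iso C \<psi> \<and> Dom C \<psi> = Cod C i' \<and> a \<Zsemi> (i' \<Zsemi> \<psi>) = i \<and> b \<Zsemi> (j' \<Zsemi> \<psi>) = j"
    using category.pullback_ex1_iso[OF category_op, of i' j' f' g'
        "inv_arr C a" "inv_arr C b" "inv_arr C c" i j] assms arr
    by simp
  have iff: "?P \<phi> \<longleftrightarrow> is_iso C \<phi> \<and> (is_iso C (inv_arr C \<phi>) \<and> Dom C (inv_arr C \<phi>) = Cod C i' \<and>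
      a \<Zsemi> (i' \<Zsemi> inv_arr C \<phi>) = i \<and> b \<Zsemi> (j' \<Zsemi> inv_arr C \<phi>) = j)" for \<phi>
    using arr iso cod by auto
  from ex1 show ?thesis unfolding iff by (metis iso_inv)
qed

end


section \<open>List objects\<close>

lemma is_list_objectD:
  assumes "is_list_object A T u v p q e c"
  shows "is_terminal A T" "Cod A u = T" "is_pullback A p q u v"
    "e \<in> Hom A T (Dom A v)" "c \<in> Hom A (Dom A p) (Dom A v)"
  using assms by (simp_all add: is_list_object_def Let_def)

context arithmetic_universe
begin

lemma to_One [simp]:
  assumes "X \<in> Obj A"
  shows "to_terminal A (One A) X \<in> Arr A" "Dom A (to_terminal A (One A) X) = X"
    "Cod A (to_terminal A (One A) X) = One A"
  using to_terminal_Hom[OF One_terminal assms] by (simp_all add: Hom_def)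

lemma product_pullback:
  assumes "X \<in> Obj A" "Y \<in> Obj A"
  shows "is_pullback A (Pr1 A X Y) (Pr2 A X Y) (to_terminal A (One A) X) (to_terminal A (One A) Y)"
  unfolding Pr1_def Pr2_def using assms by (intro Pb_pullback) simp_all

lemma product_simps [simp]:
  assumes "X \<in> Obj A" "Y \<in> Obj A"
  shows "Pr1 A X Y \<in> Arr A" "Dom A (Pr1 A X Y) = Prod A X Y" "Cod A (Pr1 A X Y) = X"
    "Pr2 A X Y \<in> Arr A" "Dom A (Pr2 A X Y) = Prod A X Y" "Cod A (Pr2 A X Y) = Y"
    "Prod A X Y \<in> Obj A"
  using pullback_simps[OF product_pullback[OF assms]] assms
  by (simp_all add: Prod_def)

lemma product_ext:
  assumes "X \<in> Obj A" "Y \<in> Obj A" "h \<in> Arr A" "k \<in> Arr A" "Dom A h = Dom A k"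
    "Cod A h = Prod A X Y" "Cod A k = Prod A X Y"
    "h \<Zsemi> Pr1 A X Y = k \<Zsemi> Pr1 A X Y" "h \<Zsemi> Pr2 A X Y = k \<Zsemi> Pr2 A X Y"
  shows "h = k"
  by (rule pullback_cancel[OF product_pullback[OF assms(1,2)]]) (use assms in simp_all)

lemma Pairing_spec:
  assumes "f \<in> Arr A" "g \<in> Arr A" "Dom A f = Dom A g"
  shows "Pairing A f g \<in> Hom A (Dom A f) (Prod A (Cod A f) (Cod A g)) \<and>
    Pairing A f g \<Zsemi> Pr1 A (Cod A f) (Cod A g) = f \<and>
    Pairing A f g \<Zsemi> Pr2 A (Cod A f) (Cod A g) = g"
proof -
  have obj: "Cod A f \<in> Obj A" "Cod A g \<in> Obj A" using assms by simp_all
  have eq: "f \<Zsemi> to_terminal A (One A) (Cod A f) = g \<Zsemi> to_terminal A (One A) (Cod A g)"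
    using assms obj by (intro terminal_unique[OF One_terminal, of _ "Dom A f"]) (simp_all add: Hom_def)
  obtain m where m: "m \<in> Hom A (Dom A f) (Dom A (Pr1 A (Cod A f) (Cod A g)))"
      "m \<Zsemi> Pr1 A (Cod A f) (Cod A g) = f" "m \<Zsemi> Pr2 A (Cod A f) (Cod A g) = g"
    using pullback_factor[OF product_pullback[OF obj], of f g] assms obj eq to_One(2) by metis
  show ?thesis
    unfolding Pairing_def
  proof (rule theI[of _ m])
    show m': "m \<in> Hom A (Dom A f) (Prod A (Cod A f) (Cod A g)) \<and>
      m \<Zsemi> Pr1 A (Cod A f) (Cod A g) = f \<and> m \<Zsemi> Pr2 A (Cod A f) (Cod A g) = g"
      using m obj by simp
    show "h = m" if "h \<in> Hom A (Dom A f) (Prod A (Cod A f) (Cod A g)) \<and>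
      h \<Zsemi> Pr1 A (Cod A f) (Cod A g) = f \<and> h \<Zsemi> Pr2 A (Cod A f) (Cod A g) = g" for h
      by (rule product_ext[OF obj]) (use that m' in \<open>simp_all add: Hom_def\<close>)
  qed
qed

lemma Pairing_simps [simp]:
  assumes "f \<in> Arr A" "g \<in> Arr A" "Dom A f = Dom A g"
  shows "Pairing A f g \<in> Arr A" "Dom A (Pairing A f g) = Dom A g"
    "Cod A (Pairing A f g) = Prod A (Cod A f) (Cod A g)"
  using Pairing_spec[OF assms] assms by (simp_all add: Hom_def)

lemma Pairing_proj [simp]:
  assumes "f \<in> Arr A" "g \<in> Arr A" "Dom A f = Dom A g" "Cod A f = X" "Cod A g = Y"
  shows "Pairing A f g \<Zsemi> Pr1 A X Y = f" "Pairing A f g \<Zsemi> Pr2 A X Y = g"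
  using Pairing_spec[OF assms(1-3)] assms by simp_all

lemma Pairing_proj_comp [simp]:
  assumes "f \<in> Arr A" "g \<in> Arr A" "Dom A f = Dom A g" "Cod A f = X" "Cod A g = Y" "h \<in> Arr A"
  shows "Dom A h = X \<Longrightarrow> Pairing A f g \<Zsemi> (Pr1 A X Y \<Zsemi> h) = f \<Zsemi> h"
    "Dom A h = Y \<Longrightarrow> Pairing A f g \<Zsemi> (Pr2 A X Y \<Zsemi> h) = g \<Zsemi> h"
proof -
  have "X \<in> Obj A" "Y \<in> Obj A" using assms by auto
  then show "Dom A h = X \<Longrightarrow> Pairing A f g \<Zsemi> (Pr1 A X Y \<Zsemi> h) = f \<Zsemi> h"
    "Dom A h = Y \<Longrightarrow> Pairing A f g \<Zsemi> (Pr2 A X Y \<Zsemi> h) = g \<Zsemi> h"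
    using assms by (simp_all flip: comp_assoc)
qed

lemma comp_Pairing:
  assumes "f \<in> Arr A" "g \<in> Arr A" "Dom A f = Dom A g" "h \<in> Arr A" "Cod A h = Dom A g"
  shows "h \<Zsemi> Pairing A f g = Pairing A (h \<Zsemi> f) (h \<Zsemi> g)"
  by (rule product_ext[of "Cod A f" "Cod A g"]) (use assms in simp_all)

text \<open>Recursion without a parameter.  It comes from parametrized recursion by taking the terminal object
  \<open>T\<close> as the parameter: the projections \<open>L \<times> T \<rightarrow> L\<close> and \<open>P \<times> T \<rightarrow> P\<close> are isomorphisms, and
  precomposition with them identifies the two recursion problems.\<close>

lemma list_fold:
  assumes lo: "is_list_object A T u v p q e c"
    and y: "y \<in> Hom A T Y" and g: "g \<in> Hom A (Prod A (Dom A u) Y) Y"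
  shows "\<exists>!f. f \<in> Hom A (Dom A v) Y \<and> e \<Zsemi> f = y \<and> c \<Zsemi> f = Pairing A p (q \<Zsemi> f) \<Zsemi> g"
proof -
  note d = is_list_objectD[OF lo]
  note s = pullback_simps[OF d(3)] d(2)
  have T: "T \<in> Obj A" using d(1) by (simp add: is_terminal_def)
  have Y: "Y \<in> Obj A" using y by (auto simp: Hom_def)
  have t: "e \<in> Arr A" "Dom A e = T" "Cod A e = Dom A v"
    "c \<in> Arr A" "Dom A c = Dom A p" "Cod A c = Dom A v"
    "y \<in> Arr A" "Dom A y = T" "Cod A y = Y"
    "g \<in> Arr A" "Dom A g = Prod A (Dom A u) Y" "Cod A g = Y"
    using d y g by (simp_all add: Hom_def)
  let ?X = "Dom A u" and ?L = "Dom A v" and ?P = "Dom A p"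
  have obj: "?X \<in> Obj A" "?L \<in> Obj A" "?P \<in> Obj A" using s by simp_all
  \<comment> \<open>A map \<open>w : Z \<rightarrow> T\<close> gives the section \<open>\<langle>id, w\<rangle>\<close> of the projection, so the latter is epic.\<close>
  have proj_cancel: "x = x'"
    if eq: "Pr1 A Z T \<Zsemi> x = Pr1 A Z T \<Zsemi> x'" and w: "w \<in> Arr A" "Dom A w = Z" "Cod A w = T"
      and x: "x \<in> Arr A" "x' \<in> Arr A" "Dom A x = Z" "Dom A x' = Z" for Z w x x'
  proof -
    have Z: "Z \<in> Obj A" using w by auto
    have "Pairing A (Idn A Z) w \<Zsemi> (Pr1 A Z T \<Zsemi> x) = Pairing A (Idn A Z) w \<Zsemi> (Pr1 A Z T \<Zsemi> x')"
      using eq by simp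
    then show ?thesis using w x Z T by simp
  qed
  have proj_split: "Pr1 A ?L T \<Zsemi> (Pairing A (Idn A ?L) v \<Zsemi> r) = r"
    if r: "r \<in> Arr A" "Dom A r = Prod A ?L T" for r
  proof -
    have "Pr1 A ?L T \<Zsemi> Pairing A (Idn A ?L) v = Idn A (Prod A ?L T)"
    proof (rule product_ext[OF obj(2) T])
      show "Pr1 A ?L T \<Zsemi> Pairing A (Idn A ?L) v \<Zsemi> Pr2 A ?L T = Idn A (Prod A ?L T) \<Zsemi> Pr2 A ?L T"
        using s t T obj by (intro terminal_unique[OF d(1), of _ "Prod A ?L T"]) (simp_all add: Hom_def)
    qed (use s t T obj in simp_all)
    then have "(Pr1 A ?L T \<Zsemi> Pairing A (Idn A ?L) v) \<Zsemi> r = Idn A (Prod A ?L T) \<Zsemi> r" by simp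
    then show ?thesis using r s t T obj by simp
  qed
  let ?R = "\<lambda>r. r \<in> Hom A (Prod A ?L T) Y \<and>
      Pairing A (to_terminal A T T \<Zsemi> e) (Idn A T) \<Zsemi> r = y \<and>
      Pairing A (Pr1 A ?P T \<Zsemi> c) (Pr2 A ?P T) \<Zsemi> r =
      Pairing A (Pr1 A ?P T \<Zsemi> p) (Pairing A (Pr1 A ?P T \<Zsemi> q) (Pr2 A ?P T) \<Zsemi> r) \<Zsemi> g"
  let ?F = "\<lambda>f. f \<in> Hom A ?L Y \<and> e \<Zsemi> f = y \<and> c \<Zsemi> f = Pairing A p (q \<Zsemi> f) \<Zsemi> g"
  \<comment> \<open>\<open>?R\<close> is the parametrized recursion problem with parameter \<open>T\<close>, and \<open>?F\<close> the plain one.\<close>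
  have ex1: "\<exists>!r. ?R r"
    using lo T Y y g unfolding is_list_object_def Let_def by blast
  have tT: "to_terminal A T T = Idn A T"
    using T by (intro terminal_unique[OF d(1), of _ T] to_terminal_Hom d(1)) (simp_all add: Hom_def)
  have iff: "?R (Pr1 A ?L T \<Zsemi> f) \<longleftrightarrow> ?F f" if f: "f \<in> Hom A ?L Y" for f
  proof -
    have ft: "f \<in> Arr A" "Dom A f = ?L" "Cod A f = Y" using f by (simp_all add: Hom_def)
    have "Pr1 A ?P T \<Zsemi> (Pairing A p (q \<Zsemi> f) \<Zsemi> g) =
        Pairing A (Pr1 A ?P T \<Zsemi> p) (Pr1 A ?P T \<Zsemi> (q \<Zsemi> f)) \<Zsemi> g"
      using ft s t T obj by (simp flip: comp_assoc add: comp_Pairing)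
    moreover have "c \<Zsemi> f = Pairing A p (q \<Zsemi> f) \<Zsemi> g \<longleftrightarrow>
        Pr1 A ?P T \<Zsemi> (c \<Zsemi> f) = Pr1 A ?P T \<Zsemi> (Pairing A p (q \<Zsemi> f) \<Zsemi> g)"
      using proj_cancel[of ?P "c \<Zsemi> f" "Pairing A p (q \<Zsemi> f) \<Zsemi> g" "p \<Zsemi> u"] ft s t T obj by auto
    ultimately show ?thesis
      using ft s t T obj by (simp add: tT Hom_def)
  qed
  from ex1 obtain r where r: "?R r" and uniq: "\<And>r'. ?R r' \<Longrightarrow> r' = r" by blast
  let ?f = "Pairing A (Idn A ?L) v \<Zsemi> r"
  have rt: "r \<in> Arr A" "Dom A r = Prod A ?L T" "Cod A r = Y" using r by (simp_all add: Hom_def)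
  have fh: "?f \<in> Hom A ?L Y" using rt s t T obj by (simp add: Hom_def)
  show ?thesis
  proof (rule ex1I[of _ ?f])
    have "?R (Pr1 A ?L T \<Zsemi> ?f)" using r by (simp only: proj_split[OF rt(1,2)])
    then show "?F ?f" using iff[OF fh] by blast
  next
    fix f assume f: "?F f"
    then have "?R (Pr1 A ?L T \<Zsemi> f)" using iff by blast
    then have "Pr1 A ?L T \<Zsemi> f = Pr1 A ?L T \<Zsemi> ?f" using uniq proj_split[OF rt(1,2)] by metis
    then show "f = ?f"
      using f fh s by (intro proj_cancel[of ?L f ?f v]) (simp_all add: Hom_def)
  qed
qed

end

text \<open>What a homomorphism of models restricts to on the three nodes of a list universal: \<open>\<tau>\<close>, \<open>f\<close> and
  \<open>m\<close> are its components at the terminal node, the list node and the pullback node, over the component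
  \<open>a\<close> at the node of list entries.  The four equations are naturality for the edges \<open>e\<close>, \<open>c\<close>, \<open>p\<close>
  and \<open>q\<close>; naturality for the other edges follows because \<open>T\<close> is terminal.\<close>

definition list_map ::
    "('o, 'm, 'z) cat_scheme \<Rightarrow> 'm \<Rightarrow> 'm \<times> 'm \<times> 'm \<times> 'm \<Rightarrow> 'm \<times> 'm \<times> 'm \<times> 'm \<Rightarrow>
     'm \<Rightarrow> 'm \<Rightarrow> 'm \<Rightarrow> bool" where
  "list_map C a = (\<lambda>(p, q, e, c) (p', q', e', c') \<tau> f m.
     \<tau> \<in> Hom C (Dom C e) (Dom C e') \<and> f \<in> Hom C (Cod C c) (Cod C c') \<and>
     m \<in> Hom C (Dom C p) (Dom C p') \<and>
     e \<Zsemi>\<^bsub>C\<^esub> f = \<tau> \<Zsemi>\<^bsub>C\<^esub> e' \<and> c \<Zsemi>\<^bsub>C\<^esub> f = m \<Zsemi>\<^bsub>C\<^esub> c' \<and>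
     m \<Zsemi>\<^bsub>C\<^esub> p' = p \<Zsemi>\<^bsub>C\<^esub> a \<and> m \<Zsemi>\<^bsub>C\<^esub> q' = q \<Zsemi>\<^bsub>C\<^esub> f)"

context arithmetic_universe
begin

text \<open>List maps over \<open>a\<close> are solutions of a plain recursion problem: if \<open>k : X \<times> L' \<rightarrow> P'\<close> is the map
  with components \<open>a\<close> and \<open>id\<close>, then \<open>m\<close> is forced to be \<open>\<langle>p, q \<Zsemi> f\<rangle> \<Zsemi> k\<close>, so that the condition
  on \<open>f\<close> is the one for folding with the step \<open>k \<Zsemi> c'\<close>.  Quantifying over \<open>y\<close> and \<open>g\<close> makes both
  existence and uniqueness of list maps available from one construction.\<close>

lemma list_map_fold:
  assumes lo: "is_list_object A T u v p q e c" and lo': "is_list_object A T' u' v' p' q' e' c'"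
    and a: "a \<in> Hom A (Dom A u) (Dom A u')"
  shows "\<exists>y g. y \<in> Hom A T (Dom A v') \<and> g \<in> Hom A (Prod A (Dom A u) (Dom A v')) (Dom A v') \<and>
    (\<forall>f. f \<in> Hom A (Dom A v) (Dom A v') \<and> e \<Zsemi> f = y \<and> c \<Zsemi> f = Pairing A p (q \<Zsemi> f) \<Zsemi> g \<longleftrightarrow>
      (\<exists>\<tau> m. list_map A a (p, q, e, c) (p', q', e', c') \<tau> f m))"
proof -
  note d = is_list_objectD[OF lo] and d' = is_list_objectD[OF lo']
  note s = pullback_simps[OF d(3)] d(2) pullback_simps[OF d'(3)] d'(2)
  let ?X = "Dom A u" and ?L' = "Dom A v'"
  have t: "e \<in> Arr A" "Dom A e = T" "Cod A e = Dom A v"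
    "c \<in> Arr A" "Dom A c = Dom A p" "Cod A c = Dom A v"
    "e' \<in> Arr A" "Dom A e' = T'" "Cod A e' = Dom A v'"
    "c' \<in> Arr A" "Dom A c' = Dom A p'" "Cod A c' = Dom A v'"
    "a \<in> Arr A" "Dom A a = Dom A u" "Cod A a = Dom A u'"
    using d d' a by (simp_all add: Hom_def)
  have obj: "?X \<in> Obj A" "?L' \<in> Obj A" "T \<in> Obj A" "T' \<in> Obj A" using s t by auto
  have tt: "to_terminal A T' T \<in> Hom A T T'" using obj by (intro to_terminal_Hom d')
  have "Pr1 A ?X ?L' \<Zsemi> a \<Zsemi> u' = Pr2 A ?X ?L' \<Zsemi> v'"
    using s t obj by (intro terminal_unique[OF d'(1), of _ "Prod A ?X ?L'"]) (simp_all add: Hom_def)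
  then obtain k where k: "k \<in> Hom A (Prod A ?X ?L') (Dom A p')"
    "k \<Zsemi> p' = Pr1 A ?X ?L' \<Zsemi> a" "k \<Zsemi> q' = Pr2 A ?X ?L'"
    using pullback_factor[OF d'(3), of "Pr1 A ?X ?L' \<Zsemi> a" "Pr2 A ?X ?L'"] s t obj by auto
  have kt: "k \<in> Arr A" "Dom A k = Prod A ?X ?L'" "Cod A k = Dom A p'" using k by (simp_all add: Hom_def)
  have m_iff: "m \<in> Hom A (Dom A p) (Dom A p') \<and> m \<Zsemi> p' = p \<Zsemi> a \<and> m \<Zsemi> q' = q \<Zsemi> f \<longleftrightarrow>
      m = Pairing A p (q \<Zsemi> f) \<Zsemi> k" if f: "f \<in> Hom A (Dom A v) (Dom A v')" for f m
  proof -
    have ft: "f \<in> Arr A" "Dom A f = Dom A v" "Cod A f = Dom A v'" using f by (simp_all add: Hom_def)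
    have n: "Pairing A p (q \<Zsemi> f) \<Zsemi> k \<in> Hom A (Dom A p) (Dom A p')"
      "Pairing A p (q \<Zsemi> f) \<Zsemi> k \<Zsemi> p' = p \<Zsemi> a" "Pairing A p (q \<Zsemi> f) \<Zsemi> k \<Zsemi> q' = q \<Zsemi> f"
      using s t ft kt obj by (simp_all add: k Hom_def)
    show ?thesis
    proof
      assume m: "m \<in> Hom A (Dom A p) (Dom A p') \<and> m \<Zsemi> p' = p \<Zsemi> a \<and> m \<Zsemi> q' = q \<Zsemi> f"
      show "m = Pairing A p (q \<Zsemi> f) \<Zsemi> k"
        by (rule pullback_cancel[OF d'(3)]) (use m n in \<open>simp_all add: Hom_def\<close>)
    qed (use n in simp)
  qed
  let ?y = "to_terminal A T' T \<Zsemi> e'" and ?g = "k \<Zsemi> c'"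
  have "?y \<in> Hom A T ?L'" "?g \<in> Hom A (Prod A ?X ?L') ?L'"
    using tt t kt by (simp_all add: Hom_def)
  moreover have "f \<in> Hom A (Dom A v) ?L' \<and> e \<Zsemi> f = ?y \<and> c \<Zsemi> f = Pairing A p (q \<Zsemi> f) \<Zsemi> ?g \<longleftrightarrow>
      (\<exists>\<tau> m. list_map A a (p, q, e, c) (p', q', e', c') \<tau> f m)" for f
  proof (cases "f \<in> Hom A (Dom A v) ?L'")
    case True
    then have ft: "f \<in> Arr A" "Dom A f = Dom A v" "Cod A f = Dom A v'" by (simp_all add: Hom_def)
    have \<tau>: "\<tau> \<in> Hom A T T' \<longleftrightarrow> \<tau> = to_terminal A T' T" for \<tau>
      using tt terminal_unique[OF d'(1)] by blast
    have "(\<exists>\<tau> m. list_map A a (p, q, e, c) (p', q', e', c') \<tau> f m) \<longleftrightarrow>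
      (\<exists>\<tau> m. \<tau> \<in> Hom A T T' \<and>
        (m \<in> Hom A (Dom A p) (Dom A p') \<and> m \<Zsemi> p' = p \<Zsemi> a \<and> m \<Zsemi> q' = q \<Zsemi> f) \<and>
        e \<Zsemi> f = \<tau> \<Zsemi> e' \<and> c \<Zsemi> f = m \<Zsemi> c')"
      using True unfolding list_map_def by (simp add: t conj_ac)
    also have "\<dots> \<longleftrightarrow> e \<Zsemi> f = ?y \<and> c \<Zsemi> f = (Pairing A p (q \<Zsemi> f) \<Zsemi> k) \<Zsemi> c'"
      unfolding m_iff[OF True] \<tau> by simp
    also have "(Pairing A p (q \<Zsemi> f) \<Zsemi> k) \<Zsemi> c' = Pairing A p (q \<Zsemi> f) \<Zsemi> ?g"
      using s t ft kt by simp
    finally show ?thesis using True by simp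
  next
    case False
    then show ?thesis by (auto simp: list_map_def t)
  qed
  ultimately show ?thesis by blast
qed

lemma list_map_exists:
  assumes lo: "is_list_object A T u v p q e c" and lo': "is_list_object A T' u' v' p' q' e' c'"
    and a: "a \<in> Hom A (Dom A u) (Dom A u')"
  obtains \<tau> f m where "list_map A a (p, q, e, c) (p', q', e', c') \<tau> f m"
proof -
  obtain y g where "y \<in> Hom A T (Dom A v')" "g \<in> Hom A (Prod A (Dom A u) (Dom A v')) (Dom A v')"
    and "\<forall>f. f \<in> Hom A (Dom A v) (Dom A v') \<and> e \<Zsemi> f = y \<and> c \<Zsemi> f = Pairing A p (q \<Zsemi> f) \<Zsemi> g \<longleftrightarrow>
      (\<exists>\<tau> m. list_map A a (p, q, e, c) (p', q', e', c') \<tau> f m)"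
    using list_map_fold[OF lo lo' a] by blast
  then show thesis using list_fold[OF lo] that by metis
qed

lemma list_map_unique:
  assumes lo: "is_list_object A T u v p q e c" and lo': "is_list_object A T' u' v' p' q' e' c'"
    and a: "a \<in> Hom A (Dom A u) (Dom A u')"
    and 1: "list_map A a (p, q, e, c) (p', q', e', c') \<tau> f m"
    and 2: "list_map A a (p, q, e, c) (p', q', e', c') \<tau>' f' m'"
  shows "\<tau> = \<tau>' \<and> f = f' \<and> m = m'"
proof -
  note d = is_list_objectD[OF lo] and d' = is_list_objectD[OF lo']
  obtain y g where "y \<in> Hom A T (Dom A v')" "g \<in> Hom A (Prod A (Dom A u) (Dom A v')) (Dom A v')"
    and "\<forall>f. f \<in> Hom A (Dom A v) (Dom A v') \<and> e \<Zsemi> f = y \<and> c \<Zsemi> f = Pairing A p (q \<Zsemi> f) \<Zsemi> g \<longleftrightarrow>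
      (\<exists>\<tau> m. list_map A a (p, q, e, c) (p', q', e', c') \<tau> f m)"
    using list_map_fold[OF lo lo' a] by blast
  then have f: "f = f'" using list_fold[OF lo] 1 2 by metis
  moreover have "\<tau> = \<tau>'"
    using 1 2 d'(1,4) terminal_unique[OF d'(1), of \<tau> "Dom A e" \<tau>'] by (simp add: list_map_def Hom_def)
  moreover have "m = m'"
    by (rule pullback_cancel[OF d'(3)]) (use 1 2 f in \<open>simp_all add: list_map_def Hom_def\<close>)
  ultimately show ?thesis by simp
qed

text \<open>The composite of the two list maps and the identity are both list maps over the identity, so
  uniqueness of list maps equates them.\<close>

lemma list_map_inverse:
  assumes lo: "is_list_object A T u v p q e c" and lo': "is_list_object A T' u' v' p' q' e' c'"
    and a: "is_iso A a" "Dom A a = Dom A u" "Cod A a = Dom A u'"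
    and f: "list_map A a (p, q, e, c) (p', q', e', c') \<tau> f m"
    and f': "list_map A (inv_arr A a) (p', q', e', c') (p, q, e, c) \<tau>' f' m'"
  shows "\<tau> \<Zsemi> \<tau>' = Idn A (Dom A \<tau>)" "f \<Zsemi> f' = Idn A (Dom A f)" "m \<Zsemi> m' = Idn A (Dom A m)"
proof -
  note d = is_list_objectD[OF lo] and d' = is_list_objectD[OF lo']
  note s = pullback_simps[OF d(3)] d(2) pullback_simps[OF d'(3)] d'(2)
  have t: "e \<in> Arr A" "Dom A e = T" "Cod A e = Dom A v"
    "c \<in> Arr A" "Dom A c = Dom A p" "Cod A c = Dom A v"
    "e' \<in> Arr A" "Dom A e' = T'" "Cod A e' = Dom A v'"
    "c' \<in> Arr A" "Dom A c' = Dom A p'" "Cod A c' = Dom A v'"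
    using d d' a by (simp_all add: Hom_def)
  have ft: "\<tau> \<in> Arr A" "Dom A \<tau> = T" "Cod A \<tau> = T'" "f \<in> Arr A" "Dom A f = Dom A v" "Cod A f = Dom A v'"
    "m \<in> Arr A" "Dom A m = Dom A p" "Cod A m = Dom A p'"
    "\<tau>' \<in> Arr A" "Dom A \<tau>' = T'" "Cod A \<tau>' = T" "f' \<in> Arr A" "Dom A f' = Dom A v'" "Cod A f' = Dom A v"
    "m' \<in> Arr A" "Dom A m' = Dom A p'" "Cod A m' = Dom A p"
    using f f' by (simp_all add: list_map_def Hom_def t)
  have e: "e \<Zsemi> f = \<tau> \<Zsemi> e'" "c \<Zsemi> f = m \<Zsemi> c'" "m \<Zsemi> p' = p \<Zsemi> a" "m \<Zsemi> q' = q \<Zsemi> f"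
    and e': "e' \<Zsemi> f' = \<tau>' \<Zsemi> e" "c' \<Zsemi> f' = m' \<Zsemi> c" "m' \<Zsemi> p = p' \<Zsemi> inv_arr A a" "m' \<Zsemi> q = q' \<Zsemi> f'"
    using f f' by (simp_all add: list_map_def)
  have comp: "list_map A (Idn A (Dom A u)) (p, q, e, c) (p, q, e, c) (\<tau> \<Zsemi> \<tau>') (f \<Zsemi> f') (m \<Zsemi> m')"
  proof -
    have "e \<Zsemi> (f \<Zsemi> f') = (e \<Zsemi> f) \<Zsemi> f'" using t ft by simp
    also have "\<dots> = \<tau> \<Zsemi> (e' \<Zsemi> f')" unfolding e using t ft by simp
    finally have 1: "e \<Zsemi> (f \<Zsemi> f') = \<tau> \<Zsemi> (\<tau>' \<Zsemi> e)" unfolding e' .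
    have "c \<Zsemi> (f \<Zsemi> f') = (c \<Zsemi> f) \<Zsemi> f'" using t ft by simp
    also have "\<dots> = m \<Zsemi> (c' \<Zsemi> f')" unfolding e using t ft by simp
    finally have 2: "c \<Zsemi> (f \<Zsemi> f') = m \<Zsemi> (m' \<Zsemi> c)" unfolding e' .
    have "m \<Zsemi> (m' \<Zsemi> p) = (m \<Zsemi> p') \<Zsemi> inv_arr A a" unfolding e' using ft s a by simp
    also have "\<dots> = p" unfolding e using s a by simp
    finally have 3: "m \<Zsemi> (m' \<Zsemi> p) = p" .
    have "m \<Zsemi> (m' \<Zsemi> q) = (m \<Zsemi> q') \<Zsemi> f'" unfolding e' using ft s by simp
    also have "\<dots> = q \<Zsemi> (f \<Zsemi> f')" unfolding e using ft s by simp
    finally have 4: "m \<Zsemi> (m' \<Zsemi> q) = q \<Zsemi> (f \<Zsemi> f')" .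
    show ?thesis unfolding list_map_def using t ft s a 1 2 3 4 by (simp add: Hom_def)
  qed
  have "list_map A (Idn A (Dom A u)) (p, q, e, c) (p, q, e, c)
      (Idn A T) (Idn A (Dom A v)) (Idn A (Dom A p))"
    unfolding list_map_def using t s by (auto simp add: Hom_def)
  from list_map_unique[OF lo lo _ comp this] s
  show "\<tau> \<Zsemi> \<tau>' = Idn A (Dom A \<tau>)" "f \<Zsemi> f' = Idn A (Dom A f)" "m \<Zsemi> m' = Idn A (Dom A m)"
    using ft by (simp_all add: Hom_def)
qed

lemma list_map_iso:
  assumes lo: "is_list_object A T u v p q e c" and lo': "is_list_object A T' u' v' p' q' e' c'"
    and a: "is_iso A a" "Dom A a = Dom A u" "Cod A a = Dom A u'"
    and f: "list_map A a (p, q, e, c) (p', q', e', c') \<tau> f m"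
  shows "is_iso A \<tau> \<and> is_iso A f \<and> is_iso A m"
proof -
  note d = is_list_objectD[OF lo] and d' = is_list_objectD[OF lo']
  obtain \<tau>' f' m' where f': "list_map A (inv_arr A a) (p', q', e', c') (p, q, e, c) \<tau>' f' m'"
    using list_map_exists[OF lo' lo, of "inv_arr A a"] a by (auto simp: Hom_def)
  have "\<tau> \<Zsemi> \<tau>' = Idn A (Dom A \<tau>)" "f \<Zsemi> f' = Idn A (Dom A f)" "m \<Zsemi> m' = Idn A (Dom A m)"
    using list_map_inverse[OF lo lo' a f f'] by simp_all
  moreover have "\<tau>' \<Zsemi> \<tau> = Idn A (Dom A \<tau>')" "f' \<Zsemi> f = Idn A (Dom A f')" "m' \<Zsemi> m = Idn A (Dom A m')"
    using list_map_inverse[OF lo' lo _ _ _ f', of \<tau> f m] f a by simp_all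
  ultimately have "are_inverse A \<tau> \<tau>'" "are_inverse A f f'" "are_inverse A m m'"
    using f f' by (simp_all add: are_inverse_def list_map_def Hom_def)
  then show ?thesis unfolding is_iso_def by blast
qed

text \<open>For the canonical list object, the strictness conditions on the components of an isomorphism at the
  three nodes amount to its being a list map over \<open>a\<close>, because both legs of the product opspan are
  maps to a terminal object, so that their conjugates are the canonical ones.  So existence and uniqueness
  of list maps yield existence and uniqueness of the components.\<close>

lemma list_straightening_iff:
  assumes lo: "is_list_object A T u v p q e c" and a: "is_iso A a" "Cod A a = Dom A u"
  defines "X \<equiv> Dom A a"
  shows "is_iso A \<tau> \<and> is_iso A f \<and> is_iso A m \<and>
      Cod A \<tau> = T \<and> Cod A f = Dom A v \<and> Cod A m = Dom A p \<and> Dom A \<tau> = One A \<and>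
      Dom A f = List A X \<and>
      m \<Zsemi> p \<Zsemi> inv_arr A a = Pb1 A (a \<Zsemi> u \<Zsemi> inv_arr A \<tau>) (f \<Zsemi> v \<Zsemi> inv_arr A \<tau>) \<and>
      m \<Zsemi> q \<Zsemi> inv_arr A f = Pb2 A (a \<Zsemi> u \<Zsemi> inv_arr A \<tau>) (f \<Zsemi> v \<Zsemi> inv_arr A \<tau>) \<and>
      \<tau> \<Zsemi> e \<Zsemi> inv_arr A f = Eps A X \<and> m \<Zsemi> c \<Zsemi> inv_arr A f = Cons A X \<longleftrightarrow>
    list_map A a (Pr1 A X (List A X), Pr2 A X (List A X), Eps A X, Cons A X) (p, q, e, c) \<tau> f m"
    (is "?S \<longleftrightarrow> ?M")
proof -
  have X: "X \<in> Obj A" "List A X \<in> Obj A" using a by (simp_all add: X_def List_Obj)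
  note lo0 = List_list_object[OF X(1)]
  note d = is_list_objectD[OF lo] and d0 = is_list_objectD[OF lo0]
  note s = pullback_simps[OF d(3)] d(2)
  have t: "e \<in> Arr A" "Dom A e = T" "Cod A e = Dom A v"
    "c \<in> Arr A" "Dom A c = Dom A p" "Cod A c = Dom A v"
    "Eps A X \<in> Arr A" "Dom A (Eps A X) = One A" "Cod A (Eps A X) = List A X"
    "Cons A X \<in> Arr A" "Dom A (Cons A X) = Prod A X (List A X)" "Cod A (Cons A X) = List A X"
    using d d0 X by (simp_all add: Hom_def)
  have aX: "Dom A a = X" by (simp add: X_def)
  have pb: "Pb1 A (a \<Zsemi> u \<Zsemi> inv_arr A \<tau>) (f \<Zsemi> v \<Zsemi> inv_arr A \<tau>) = Pr1 A X (List A X) \<and>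
      Pb2 A (a \<Zsemi> u \<Zsemi> inv_arr A \<tau>) (f \<Zsemi> v \<Zsemi> inv_arr A \<tau>) = Pr2 A X (List A X)"
    if "is_iso A \<tau>" "is_iso A f" "Dom A \<tau> = One A" "Cod A \<tau> = T" "Dom A f = List A X" "Cod A f = Dom A v"
  proof -
    have "a \<Zsemi> u \<Zsemi> inv_arr A \<tau> = to_terminal A (One A) X"
      using that a aX s X by (intro terminal_unique[OF One_terminal, of _ X]) (simp_all add: Hom_def)
    moreover have "f \<Zsemi> v \<Zsemi> inv_arr A \<tau> = to_terminal A (One A) (List A X)"
      using that s X by (intro terminal_unique[OF One_terminal, of _ "List A X"]) (simp_all add: Hom_def)
    ultimately show ?thesis by (simp add: Pr1_def Pr2_def)
  qed
  show ?thesis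
  proof
    assume S: ?S
    then have i: "is_iso A \<tau>" "is_iso A f" "is_iso A m" "Cod A \<tau> = T" "Cod A f = Dom A v"
      "Cod A m = Dom A p" "Dom A \<tau> = One A" "Dom A f = List A X" by simp_all
    have eq: "m \<Zsemi> p \<Zsemi> inv_arr A a = Pr1 A X (List A X)" "m \<Zsemi> q \<Zsemi> inv_arr A f = Pr2 A X (List A X)"
      "\<tau> \<Zsemi> e \<Zsemi> inv_arr A f = Eps A X" "m \<Zsemi> c \<Zsemi> inv_arr A f = Cons A X"
      using S pb by simp_all
    have "Dom A m = Dom A (m \<Zsemi> p \<Zsemi> inv_arr A a)" using i s a by simp
    then have Dm: "Dom A m = Prod A X (List A X)" using X by (simp only: eq) simp
    have "m \<Zsemi> p = Pr1 A X (List A X) \<Zsemi> a" "m \<Zsemi> q = Pr2 A X (List A X) \<Zsemi> f"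
      "\<tau> \<Zsemi> e = Eps A X \<Zsemi> f" "m \<Zsemi> c = Cons A X \<Zsemi> f"
      using i s t a Dm by (simp_all flip: eq)
    then show ?M unfolding list_map_def using i Dm s t X by (simp add: Hom_def)
  next
    assume M: ?M
    then have i: "is_iso A \<tau>" "is_iso A f" "is_iso A m"
      using list_map_iso[OF lo0 lo, of a \<tau> f m] a aX X by simp_all
    have tm: "Dom A \<tau> = One A" "Cod A \<tau> = T" "Dom A f = List A X" "Cod A f = Dom A v"
      "Dom A m = Prod A X (List A X)" "Cod A m = Dom A p"
      and eq: "m \<Zsemi> p = Pr1 A X (List A X) \<Zsemi> a" "m \<Zsemi> q = Pr2 A X (List A X) \<Zsemi> f"
      "\<tau> \<Zsemi> e = Eps A X \<Zsemi> f" "m \<Zsemi> c = Cons A X \<Zsemi> f"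
      using M X t s by (simp_all add: list_map_def Hom_def)
    have "m \<Zsemi> p \<Zsemi> inv_arr A a = Pr1 A X (List A X)" "m \<Zsemi> q \<Zsemi> inv_arr A f = Pr2 A X (List A X)"
      "\<tau> \<Zsemi> e \<Zsemi> inv_arr A f = Eps A X" "m \<Zsemi> c \<Zsemi> inv_arr A f = Cons A X"
      unfolding eq using i tm s t a X aX by simp_all
    then show ?S using i tm pb by simp
  qed
qed

end


section \<open>Sketches and subsketches\<close>

lemma sketch_edge:
  "is_sketch S \<Longrightarrow> f \<in> edges S \<Longrightarrow> src S f \<in> nodes S \<and> tgt S f \<in> nodes S"
  by (simp add: is_sketch_def)

lemma sketch_ident:
  "is_sketch S \<Longrightarrow> X \<in> nodes S \<Longrightarrow>
    ident S X \<in> edges S \<and> src S (ident S X) = X \<and> tgt S (ident S X) = X"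
  by (simp add: is_sketch_def)

lemma sketch_comm:
  assumes "is_sketch S" "k \<in> comms S"
  shows "fst_edge S k \<in> edges S" "snd_edge S k \<in> edges S" "comp_edge S k \<in> edges S"
    "src S (snd_edge S k) = tgt S (fst_edge S k)"
    "src S (comp_edge S k) = src S (fst_edge S k)"
    "tgt S (comp_edge S k) = tgt S (snd_edge S k)"
  using assms by (simp_all add: is_sketch_def)

lemma sketch_pullback:
  assumes S: "is_sketch S" and w: "w \<in> pullbacks S"
  shows "pb_comm1 S w \<in> comms S" "pb_comm2 S w \<in> comms S"
    "pb_proj1 S w \<in> edges S" "pb_proj2 S w \<in> edges S" "pb_leg1 S w \<in> edges S" "pb_leg2 S w \<in> edges S"
    "pb_diag S w \<in> edges S"
    "src S (pb_proj1 S w) = pb_node S w" "src S (pb_proj2 S w) = pb_node S w"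
    "tgt S (pb_proj1 S w) = src S (pb_leg1 S w)" "tgt S (pb_proj2 S w) = src S (pb_leg2 S w)"
    "tgt S (pb_leg2 S w) = tgt S (pb_leg1 S w)"
proof -
  have k: "pb_comm1 S w \<in> comms S" "pb_comm2 S w \<in> comms S"
    and e: "comp_edge S (pb_comm2 S w) = pb_diag S w"
    using S w by (simp_all add: is_sketch_def)
  note c = sketch_comm[OF S k(1)] sketch_comm[OF S k(2)]
  show "pb_comm1 S w \<in> comms S" "pb_comm2 S w \<in> comms S" by (fact k)+
  show "pb_proj1 S w \<in> edges S" "pb_proj2 S w \<in> edges S" "pb_leg1 S w \<in> edges S" "pb_leg2 S w \<in> edges S"
    "pb_diag S w \<in> edges S" by (fact c)+
  show "src S (pb_proj1 S w) = pb_node S w" "src S (pb_proj2 S w) = pb_node S w"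
    "tgt S (pb_proj1 S w) = src S (pb_leg1 S w)" "tgt S (pb_proj2 S w) = src S (pb_leg2 S w)"
    "tgt S (pb_leg2 S w) = tgt S (pb_leg1 S w)"
    using c e by metis+
qed

lemma sketch_pushout:
  assumes S: "is_sketch S" and w: "w \<in> pushouts S"
  shows "po_comm1 S w \<in> comms S" "po_comm2 S w \<in> comms S"
    "po_inj1 S w \<in> edges S" "po_inj2 S w \<in> edges S" "po_leg1 S w \<in> edges S" "po_leg2 S w \<in> edges S"
    "po_diag S w \<in> edges S"
    "tgt S (po_inj1 S w) = po_node S w" "tgt S (po_inj2 S w) = po_node S w"
    "src S (po_inj1 S w) = tgt S (po_leg1 S w)" "src S (po_inj2 S w) = tgt S (po_leg2 S w)"
    "src S (po_leg2 S w) = src S (po_leg1 S w)"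
proof -
  have k: "po_comm1 S w \<in> comms S" "po_comm2 S w \<in> comms S"
    and e: "comp_edge S (po_comm2 S w) = po_diag S w"
    using S w by (simp_all add: is_sketch_def)
  note c = sketch_comm[OF S k(1)] sketch_comm[OF S k(2)]
  show "po_comm1 S w \<in> comms S" "po_comm2 S w \<in> comms S" by (fact k)+
  show "po_inj1 S w \<in> edges S" "po_inj2 S w \<in> edges S" "po_leg1 S w \<in> edges S" "po_leg2 S w \<in> edges S"
    "po_diag S w \<in> edges S" by (fact c)+
  show "tgt S (po_inj1 S w) = po_node S w" "tgt S (po_inj2 S w) = po_node S w"
    "src S (po_inj1 S w) = tgt S (po_leg1 S w)" "src S (po_inj2 S w) = tgt S (po_leg2 S w)"
    "src S (po_leg2 S w) = src S (po_leg1 S w)"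
    using c e by metis+
qed

lemma sketch_list:
  assumes S: "is_sketch S" and l: "l \<in> lists S"
  shows "list_terminal S l \<in> terminals S" "list_pullback S l \<in> pullbacks S"
    "tgt S (pb_leg1 S (list_pullback S l)) = terminal_node S (list_terminal S l)"
    "list_eps S l \<in> edges S" "src S (list_eps S l) = terminal_node S (list_terminal S l)"
    "tgt S (list_eps S l) = list_node S l"
    "list_cons S l \<in> edges S" "src S (list_cons S l) = pb_node S (list_pullback S l)"
    "tgt S (list_cons S l) = list_node S l"
  using assms by (simp_all add: is_sketch_def)

lemma subsketch_edge:
  "subsketch U V \<Longrightarrow> f \<in> edges U \<Longrightarrow> src V f = src U f \<and> tgt V f = tgt U f"
  by (simp add: subsketch_def)

lemma subsketch_comm:
  "subsketch U V \<Longrightarrow> k \<in> comms U \<Longrightarrow>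
    fst_edge V k = fst_edge U k \<and> snd_edge V k = snd_edge U k \<and> comp_edge V k = comp_edge U k"
  by (simp add: subsketch_def)

lemma subsketch_pullback:
  assumes UV: "subsketch U V" and w: "w \<in> pullbacks U"
  shows "pb_proj1 V w = pb_proj1 U w" "pb_proj2 V w = pb_proj2 U w" "pb_leg1 V w = pb_leg1 U w"
    "pb_leg2 V w = pb_leg2 U w" "pb_diag V w = pb_diag U w"
    "pb_node V w = pb_node U w" "src V (pb_leg1 U w) = src U (pb_leg1 U w)"
    "src V (pb_leg2 U w) = src U (pb_leg2 U w)"
proof -
  have U: "is_sketch U" and eq: "pb_comm1 V w = pb_comm1 U w" "pb_comm2 V w = pb_comm2 U w"
    using UV w by (simp_all add: subsketch_def)
  note s = sketch_pullback[OF U w]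
  show "pb_proj1 V w = pb_proj1 U w" "pb_proj2 V w = pb_proj2 U w" "pb_leg1 V w = pb_leg1 U w"
    "pb_leg2 V w = pb_leg2 U w" "pb_diag V w = pb_diag U w" "pb_node V w = pb_node U w"
    "src V (pb_leg1 U w) = src U (pb_leg1 U w)" "src V (pb_leg2 U w) = src U (pb_leg2 U w)"
    using subsketch_comm[OF UV s(1)] subsketch_comm[OF UV s(2)] subsketch_edge[OF UV] s
    by (simp_all add: eq)
qed

lemma subsketch_pushout:
  assumes UV: "subsketch U V" and w: "w \<in> pushouts U"
  shows "po_inj1 V w = po_inj1 U w" "po_inj2 V w = po_inj2 U w" "po_leg1 V w = po_leg1 U w"
    "po_leg2 V w = po_leg2 U w" "po_node V w = po_node U w"
proof -
  have U: "is_sketch U" and eq: "po_comm1 V w = po_comm1 U w" "po_comm2 V w = po_comm2 U w"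
    using UV w by (simp_all add: subsketch_def)
  note s = sketch_pushout[OF U w]
  show "po_inj1 V w = po_inj1 U w" "po_inj2 V w = po_inj2 U w" "po_leg1 V w = po_leg1 U w"
    "po_leg2 V w = po_leg2 U w" "po_node V w = po_node U w"
    using subsketch_comm[OF UV s(1)] subsketch_comm[OF UV s(2)] subsketch_edge[OF UV] s
    by (simp_all add: eq)
qed

lemma subsketch_list:
  assumes UV: "subsketch U V" and l: "l \<in> lists U"
  shows "list_terminal V l = list_terminal U l" "list_pullback V l = list_pullback U l"
    "list_eps V l = list_eps U l" "list_cons V l = list_cons U l"
    "list_node V l = list_node U l" "list_arg V l = list_arg U l"
    "terminal_node V (list_terminal V l) = terminal_node U (list_terminal U l)"
proof -
  have U: "is_sketch U" and eq: "list_terminal V l = list_terminal U l" "list_pullback V l = list_pullback U l"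
    "list_eps V l = list_eps U l" "list_cons V l = list_cons U l"
    using UV l by (simp_all add: subsketch_def)
  note s = sketch_list[OF U l]
  show "list_terminal V l = list_terminal U l" "list_pullback V l = list_pullback U l"
    "list_eps V l = list_eps U l" "list_cons V l = list_cons U l"
    "list_node V l = list_node U l" "list_arg V l = list_arg U l"
    "terminal_node V (list_terminal V l) = terminal_node U (list_terminal U l)"
    using s UV subsketch_pullback[OF UV s(2)] by (simp_all add: eq subsketch_def)
qed

lemma subsketch_refl: "is_sketch S \<Longrightarrow> subsketch S S"
  by (simp add: subsketch_def)

lemma subsketch_trans: "subsketch U V \<Longrightarrow> subsketch V W \<Longrightarrow> subsketch U W"
  unfolding subsketch_def by (elim conjE, intro conjI) (blast | simp add: subset_iff)+

lemma simple_extension_subsketch: "simple_extension U V \<Longrightarrow> subsketch U V"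
  by (induction rule: simple_extension.induct) (simp_all add: extends_by_def)


section \<open>Straightening families\<close>

text \<open>If \<open>\<phi>\<close> is an isomorphism onto \<open>M\<close> of some other model, naturality forces that model to interpret
  \<open>f\<close> by this conjugate.\<close>

definition conj_edge ::
    "('n, 'e, 'u) sketch \<Rightarrow> ('o, 'm) au \<Rightarrow> ('n, 'e, 'o, 'm) interp \<Rightarrow> ('n \<Rightarrow> 'm) \<Rightarrow> 'e \<Rightarrow> 'm" where
  "conj_edge S A M \<phi> f = \<phi> (src S f) \<Zsemi>\<^bsub>A\<^esub> edge_map M f \<Zsemi>\<^bsub>A\<^esub> inv_arr A (\<phi> (tgt S f))"

definition transport ::
    "('n, 'e, 'u) sketch \<Rightarrow> ('o, 'm) au \<Rightarrow> ('n, 'e, 'o, 'm) interp \<Rightarrow> ('n \<Rightarrow> 'm) \<Rightarrow>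
     ('n, 'e, 'o, 'm) interp" where
  "transport S A M \<phi> = \<lparr>node_map = restrict (\<lambda>X. Dom A (\<phi> X)) (nodes S),
     edge_map = restrict (conj_edge S A M \<phi>) (edges S)\<rparr>"

text \<open>The strictness conditions on the transported interpretation, written in terms of \<open>\<phi>\<close> alone.  The
  families range over all functions on nodes, and the sets of nodes and universals to be tested are
  parameters, so that the conditions at the old and at the new ingredients of an extension can be
  separated.\<close>

definition straightens_at ::
    "('n, 'e, 'u) sketch \<Rightarrow> ('o, 'm) au \<Rightarrow> ('n, 'e, 'o, 'm) interp \<Rightarrow> ('n \<Rightarrow> 'm) \<Rightarrow>
     'n set \<Rightarrow> 'u set \<Rightarrow> 'u set \<Rightarrow> 'u set \<Rightarrow> 'u set \<Rightarrow> 'u set \<Rightarrow> bool" where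
  "straightens_at S A M \<phi> ns ts ws os qs ls \<longleftrightarrow>
    (\<forall>X\<in>ns. is_iso A (\<phi> X) \<and> Cod A (\<phi> X) = node_map M X) \<and>
    (\<forall>t\<in>ts. Dom A (\<phi> (terminal_node S t)) = One A) \<and>
    (\<forall>t\<in>os. Dom A (\<phi> (initial_node S t)) = Zero A) \<and>
    (\<forall>w\<in>ws.
      conj_edge S A M \<phi> (pb_proj1 S w) =
        Pb1 A (conj_edge S A M \<phi> (pb_leg1 S w)) (conj_edge S A M \<phi> (pb_leg2 S w)) \<and>
      conj_edge S A M \<phi> (pb_proj2 S w) =
        Pb2 A (conj_edge S A M \<phi> (pb_leg1 S w)) (conj_edge S A M \<phi> (pb_leg2 S w))) \<and>
    (\<forall>w\<in>qs.
      conj_edge S A M \<phi> (po_inj1 S w) =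
        Po1 A (conj_edge S A M \<phi> (po_leg1 S w)) (conj_edge S A M \<phi> (po_leg2 S w)) \<and>
      conj_edge S A M \<phi> (po_inj2 S w) =
        Po2 A (conj_edge S A M \<phi> (po_leg1 S w)) (conj_edge S A M \<phi> (po_leg2 S w))) \<and>
    (\<forall>l\<in>ls.
      Dom A (\<phi> (list_node S l)) = List A (Dom A (\<phi> (list_arg S l))) \<and>
      conj_edge S A M \<phi> (list_eps S l) = Eps A (Dom A (\<phi> (list_arg S l))) \<and>
      conj_edge S A M \<phi> (list_cons S l) = Cons A (Dom A (\<phi> (list_arg S l))))"

definition straightens ::
    "('n, 'e, 'u) sketch \<Rightarrow> ('o, 'm) au \<Rightarrow> ('n, 'e, 'o, 'm) interp \<Rightarrow> ('n \<Rightarrow> 'm) \<Rightarrow> bool" where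
  "straightens S A M \<phi> \<longleftrightarrow>
    straightens_at S A M \<phi> (nodes S) (terminals S) (pullbacks S) (initials S) (pushouts S) (lists S)"

lemma straightens_iso: "straightens S A M \<phi> \<Longrightarrow> X \<in> nodes S \<Longrightarrow> is_iso A (\<phi> X) \<and> Cod A (\<phi> X) = node_map M X"
  by (simp add: straightens_def straightens_at_def)

lemma interpretation_ofD:
  assumes "interpretation_of S A M"
  shows "f \<in> edges S \<Longrightarrow> edge_map M f \<in> Hom A (node_map M (src S f)) (node_map M (tgt S f))"
    "X \<in> nodes S \<Longrightarrow> node_map M X \<in> Obj A"
    "X \<in> nodes S \<Longrightarrow> edge_map M (ident S X) = Idn A (node_map M X)"
    "k \<in> comms S \<Longrightarrow> edge_map M (fst_edge S k) \<Zsemi>\<^bsub>A\<^esub> edge_map M (snd_edge S k) = edge_map M (comp_edge S k)"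
  using assms by (auto simp: interpretation_of_def)


context arithmetic_universe
begin

lemma conj_edge_simps:
  assumes "is_iso A (\<phi> (src S f))" "is_iso A (\<phi> (tgt S f))"
    "edge_map M f \<in> Hom A (Cod A (\<phi> (src S f))) (Cod A (\<phi> (tgt S f)))"
  shows "conj_edge S A M \<phi> f \<in> Arr A" "Dom A (conj_edge S A M \<phi> f) = Dom A (\<phi> (src S f))"
    "Cod A (conj_edge S A M \<phi> f) = Dom A (\<phi> (tgt S f))"
  using assms by (simp_all add: conj_edge_def Hom_def)

text \<open>Conjugation by isomorphisms preserves identities and composition, so transport never breaks a
  commutativity.\<close>

lemma transport_interpretation:
  assumes S: "is_sketch S" and M: "interpretation_of S A M"
    and iso: "\<And>X. X \<in> nodes S \<Longrightarrow> is_iso A (\<phi> X) \<and> Cod A (\<phi> X) = node_map M X"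
  shows "interpretation_of S A (transport S A M \<phi>)"
proof -
  have E: "edge_map M f \<in> Arr A" "Dom A (edge_map M f) = Cod A (\<phi> (src S f))"
    "Cod A (edge_map M f) = Cod A (\<phi> (tgt S f))" "is_iso A (\<phi> (src S f))" "is_iso A (\<phi> (tgt S f))"
    if "f \<in> edges S" for f
    using interpretation_ofD(1)[OF M that] sketch_edge[OF S that] iso by (simp_all add: Hom_def)
  have "conj_edge S A M \<phi> (fst_edge S k) \<Zsemi> conj_edge S A M \<phi> (snd_edge S k) =
      conj_edge S A M \<phi> (comp_edge S k)" if k: "k \<in> comms S" for k
  proof -
    note c = sketch_comm[OF S k]
    have "conj_edge S A M \<phi> (fst_edge S k) \<Zsemi> conj_edge S A M \<phi> (snd_edge S k) =
      \<phi> (src S (fst_edge S k)) \<Zsemi> (edge_map M (fst_edge S k) \<Zsemi> edge_map M (snd_edge S k))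
        \<Zsemi> inv_arr A (\<phi> (tgt S (snd_edge S k)))"
      using E[OF c(1)] E[OF c(2)] c(4) by (simp add: conj_edge_def)
    then show ?thesis
      using interpretation_ofD(4)[OF M k] c by (simp add: conj_edge_def)
  qed
  moreover have "conj_edge S A M \<phi> (ident S X) = Idn A (Dom A (\<phi> X))" if X: "X \<in> nodes S" for X
  proof -
    have "edge_map M (ident S X) = Idn A (Cod A (\<phi> X))"
      using interpretation_ofD(3)[OF M X] iso[OF X] by simp
    then show ?thesis
      using sketch_ident[OF S X] iso[OF X] by (simp add: conj_edge_def)
  qed
  moreover have "conj_edge S A M \<phi> f \<in> Hom A (Dom A (\<phi> (src S f))) (Dom A (\<phi> (tgt S f)))"
    if "f \<in> edges S" for f
    using E[OF that] conj_edge_simps[of \<phi> S f M] by (simp add: Hom_def)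
  ultimately show ?thesis
    unfolding interpretation_of_def transport_def
    using iso sketch_edge[OF S] sketch_ident[OF S] sketch_comm(1-3)[OF S]
    by simp
qed

lemma transport_strict_iff:
  assumes S: "is_sketch S" and M: "interpretation_of S A M"
    and iso: "\<And>X. X \<in> nodes S \<Longrightarrow> is_iso A (\<phi> X) \<and> Cod A (\<phi> X) = node_map M X"
  shows "strict_model S A (transport S A M \<phi>) \<longleftrightarrow> straightens S A M \<phi>"
proof -
  have node: "node_map (transport S A M \<phi>) X = Dom A (\<phi> X)" if "X \<in> nodes S" for X
    using that by (simp add: transport_def)
  have edge: "edge_map (transport S A M \<phi>) f = conj_edge S A M \<phi> f" if "f \<in> edges S" for f
    using that by (simp add: transport_def)
  have t: "terminal_node S t \<in> nodes S" if "t \<in> terminals S" for t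
    using S that by (simp add: is_sketch_def)
  have i: "initial_node S t \<in> nodes S" if "t \<in> initials S" for t
    using S that by (simp add: is_sketch_def)
  have l: "list_node S l \<in> nodes S \<and> list_arg S l \<in> nodes S" if "l \<in> lists S" for l
    using sketch_pullback[OF S sketch_list(2)[OF S that]] sketch_edge[OF S] by simp
  show ?thesis
    unfolding strict_model_def straightens_def straightens_at_def
    using transport_interpretation[OF S M iso] iso
    by (simp add: node edge t i l sketch_pullback[OF S] sketch_pushout[OF S] sketch_list[OF S]
        cong: ball_cong)
qed

lemma model_iso_transport:
  assumes S: "is_sketch S" and M: "interpretation_of S A M" and M0: "interpretation_of S A M0"
    and \<phi>: "model_iso S A M0 M \<phi>"
  shows "M0 = transport S A M \<phi>" "X \<in> nodes S \<Longrightarrow> is_iso A (\<phi> X) \<and> Cod A (\<phi> X) = node_map M X"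
proof -
  obtain \<psi> where \<psi>: "model_hom S A M M0 \<psi>"
    and inv: "\<And>X. X \<in> nodes S \<Longrightarrow> \<phi> X \<Zsemi> \<psi> X = Idn A (node_map M0 X) \<and> \<psi> X \<Zsemi> \<phi> X = Idn A (node_map M X)"
    and hom: "model_hom S A M0 M \<phi>"
    using \<phi> unfolding model_iso_def by blast
  have h: "\<phi> X \<in> Hom A (node_map M0 X) (node_map M X)" "\<psi> X \<in> Hom A (node_map M X) (node_map M0 X)"
    if "X \<in> nodes S" for X
    using hom \<psi> that by (auto simp: model_hom_def)
  have iso: "is_iso A (\<phi> X) \<and> Dom A (\<phi> X) = node_map M0 X \<and> Cod A (\<phi> X) = node_map M X"
    if "X \<in> nodes S" for X
  proof -
    have "are_inverse A (\<phi> X) (\<psi> X)" using h[OF that] inv[OF that] by (simp add: are_inverse_def Hom_def)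
    then show ?thesis using h[OF that] by (auto simp: is_iso_def Hom_def)
  qed
  then show "X \<in> nodes S \<Longrightarrow> is_iso A (\<phi> X) \<and> Cod A (\<phi> X) = node_map M X" by simp
  have edge: "edge_map M0 f = conj_edge S A M \<phi> f" if f: "f \<in> edges S" for f
  proof -
    note n = iso[OF conjunct1[OF sketch_edge[OF S f]]] iso[OF conjunct2[OF sketch_edge[OF S f]]]
    note e = interpretation_ofD(1)[OF M f] interpretation_ofD(1)[OF M0 f]
    have "edge_map M0 f \<Zsemi> \<phi> (tgt S f) = \<phi> (src S f) \<Zsemi> edge_map M f"
      using hom f by (simp add: model_hom_def)
    then have "edge_map M0 f \<Zsemi> \<phi> (tgt S f) \<Zsemi> inv_arr A (\<phi> (tgt S f)) = conj_edge S A M \<phi> f"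
      by (simp add: conj_edge_def)
    then show ?thesis using n e by (simp add: Hom_def)
  qed
  have "node_map M0 = restrict (\<lambda>X. Dom A (\<phi> X)) (nodes S)"
    using M0 iso by (intro ext) (auto simp: interpretation_of_def PiE_def extensional_def)
  moreover have "edge_map M0 = restrict (conj_edge S A M \<phi>) (edges S)"
    using M0 edge by (intro ext) (auto simp: interpretation_of_def PiE_def extensional_def)
  ultimately show "M0 = transport S A M \<phi>" by (simp add: transport_def)
qed

lemma transport_model_iso:
  assumes S: "is_sketch S" and M: "interpretation_of S A M"
    and iso: "\<And>X. X \<in> nodes S \<Longrightarrow> is_iso A (\<phi> X) \<and> Cod A (\<phi> X) = node_map M X"
    and ext: "\<phi> \<in> extensional (nodes S)"
  shows "model_iso S A (transport S A M \<phi>) M \<phi>"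
  unfolding model_iso_def
proof (intro conjI exI)
  let ?\<psi> = "restrict (\<lambda>X. inv_arr A (\<phi> X)) (nodes S)"
  have node: "node_map (transport S A M \<phi>) X = Dom A (\<phi> X)" if "X \<in> nodes S" for X
    using that by (simp add: transport_def)
  have edge: "edge_map (transport S A M \<phi>) f = conj_edge S A M \<phi> f" if "f \<in> edges S" for f
    using that by (simp add: transport_def)
  have E: "edge_map M f \<in> Arr A" "Dom A (edge_map M f) = Cod A (\<phi> (src S f))"
    "Cod A (edge_map M f) = Cod A (\<phi> (tgt S f))" "is_iso A (\<phi> (src S f))" "is_iso A (\<phi> (tgt S f))"
    if "f \<in> edges S" for f
    using interpretation_ofD(1)[OF M that] sketch_edge[OF S that] iso by (simp_all add: Hom_def)
  show "model_hom S A (transport S A M \<phi>) M \<phi>"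
    unfolding model_hom_def
    using ext iso E sketch_edge[OF S] by (simp add: PiE_def node edge conj_edge_def Hom_def)
  show "model_hom S A M (transport S A M \<phi>) ?\<psi>"
    unfolding model_hom_def
    using iso E sketch_edge[OF S] by (simp add: node edge conj_edge_def Hom_def)
  show "\<forall>X\<in>nodes S. \<phi> X \<Zsemi> ?\<psi> X = Idn A (node_map (transport S A M \<phi>) X) \<and>
      ?\<psi> X \<Zsemi> \<phi> X = Idn A (node_map M X)"
    using iso by (simp add: node)
qed

text \<open>The reduction on which everything rests: a strict model with an isomorphism onto \<open>M\<close> is the same
  as a straightening family of \<open>M\<close>.  What remains is a question about families of isomorphisms.\<close>

lemma strict_model_iso_iff:
  assumes S: "is_sketch S" and M: "interpretation_of S A M"
  shows "strict_model S A M0 \<and> model_iso S A M0 M \<phi> \<longleftrightarrow>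
    \<phi> \<in> extensional (nodes S) \<and> straightens S A M \<phi> \<and> M0 = transport S A M \<phi>"
proof
  assume a: "strict_model S A M0 \<and> model_iso S A M0 M \<phi>"
  then have i: "interpretation_of S A M0" by (simp add: strict_model_def)
  have "\<phi> \<in> extensional (nodes S)" using a by (simp add: model_iso_def model_hom_def PiE_def)
  then show "\<phi> \<in> extensional (nodes S) \<and> straightens S A M \<phi> \<and> M0 = transport S A M \<phi>"
    using a model_iso_transport[OF S M i, of \<phi>] transport_strict_iff[OF S M, of \<phi>] by metis
next
  assume a: "\<phi> \<in> extensional (nodes S) \<and> straightens S A M \<phi> \<and> M0 = transport S A M \<phi>"
  then show "strict_model S A M0 \<and> model_iso S A M0 M \<phi>"
    using transport_strict_iff[OF S M, of \<phi>] transport_model_iso[OF S M, of \<phi>] straightens_iso by metis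
qed

end


section \<open>Straightenings extend uniquely along simple extensions\<close>

lemma straightens_at_Un:
  "straightens_at S A M \<phi> (ns \<union> ns') (ts \<union> ts') (ws \<union> ws') (os \<union> os') (qs \<union> qs') (ls \<union> ls') \<longleftrightarrow>
    straightens_at S A M \<phi> ns ts ws os qs ls \<and> straightens_at S A M \<phi> ns' ts' ws' os' qs' ls'"
  unfolding straightens_at_def ball_Un by blast

lemma straightens_at_subsketch:
  assumes UV: "subsketch U V"
  shows "straightens_at V A M \<phi> (nodes U) (terminals U) (pullbacks U) (initials U) (pushouts U) (lists U)
    \<longleftrightarrow> straightens U A M \<phi>"
proof -
  have U: "is_sketch U" using UV by (simp add: subsketch_def)
  have edge: "conj_edge V A M \<phi> f = conj_edge U A M \<phi> f" if "f \<in> edges U" for f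
    using subsketch_edge[OF UV that] by (simp add: conj_edge_def)
  have t: "terminal_node V t = terminal_node U t" if "t \<in> terminals U" for t
    using UV that by (simp add: subsketch_def)
  have i: "initial_node V t = initial_node U t" if "t \<in> initials U" for t
    using UV that by (simp add: subsketch_def)
  note s = sketch_pullback(3-6)[OF U] sketch_pushout(3-6)[OF U] sketch_list(4,7)[OF U]
    subsketch_pullback(1-4)[OF UV] subsketch_pushout(1-4)[OF UV]
    subsketch_list(3-6)[OF UV]
  show ?thesis
    unfolding straightens_def straightens_at_def
    by (simp add: edge t i s cong: ball_cong)
qed

lemma straightens_extends:
  assumes "extends_by U V ns es ks ts ws os qs ls"
  shows "straightens V A M \<phi> \<longleftrightarrow> straightens U A M \<phi> \<and>
    straightens_at V A M \<phi> (set ns) (set ts) (set ws) (set os) (set qs) (set ls)"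
proof -
  have UV: "subsketch U V" and eq: "nodes V = nodes U \<union> set ns" "terminals V = terminals U \<union> set ts"
    "pullbacks V = pullbacks U \<union> set ws" "initials V = initials U \<union> set os"
    "pushouts V = pushouts U \<union> set qs" "lists V = lists U \<union> set ls"
    using assms by (simp_all add: extends_by_def adjoins_def)
  show ?thesis
    unfolding straightens_def[of V] eq straightens_at_Un straightens_at_subsketch[OF UV] ..
qed

text \<open>The strictness conditions read a family at the nodes of the sketch only; this allows restricting
  it to them and changing it at fresh nodes.\<close>

lemma straightens_cong:
  assumes S: "is_sketch S" and eq: "\<And>X. X \<in> nodes S \<Longrightarrow> \<phi> X = \<phi>' X"
    and \<phi>: "straightens S A M \<phi>"
  shows "straightens S A M \<phi>'"
proof -
  have edge: "conj_edge S A M \<phi>' f = conj_edge S A M \<phi> f" if "f \<in> edges S" for f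
    using sketch_edge[OF S that] eq by (simp add: conj_edge_def)
  have t: "terminal_node S t \<in> nodes S" if "t \<in> terminals S" for t
    using S that by (simp add: is_sketch_def)
  have i: "initial_node S t \<in> nodes S" if "t \<in> initials S" for t
    using S that by (simp add: is_sketch_def)
  have l: "list_node S l \<in> nodes S \<and> list_arg S l \<in> nodes S" if "l \<in> lists S" for l
    using sketch_pullback[OF S sketch_list(2)[OF S that]] sketch_edge[OF S] by simp
  note s = sketch_pullback(3-6)[OF S] sketch_pushout(3-6)[OF S] sketch_list(4,7)[OF S]
  show ?thesis
    using \<phi> unfolding straightens_def straightens_at_def
    by (simp add: edge t i l s eq[symmetric] cong: ball_cong)
qed

text \<open>The induction hypothesis.  Uniqueness is relative to the components at the primitive nodes, at
  which strictness imposes nothing: there any isomorphism would do.\<close>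

definition uniquely_straightenable ::
    "('n, 'e, 'u) sketch \<Rightarrow> ('o, 'm) au \<Rightarrow> ('n, 'e, 'o, 'm) interp \<Rightarrow> bool" where
  "uniquely_straightenable S A M \<longleftrightarrow>
    (\<exists>\<phi>. straightens S A M \<phi> \<and> (\<forall>X\<in>primitive_nodes S. \<phi> X = Idn A (node_map M X))) \<and>
    (\<forall>\<phi> \<phi>'. straightens S A M \<phi> \<longrightarrow> straightens S A M \<phi>' \<longrightarrow>
      (\<forall>X\<in>primitive_nodes S. \<phi> X = \<phi>' X) \<longrightarrow> (\<forall>X\<in>nodes S. \<phi> X = \<phi>' X))"

definition universal_nodes :: "('n, 'e, 'u) sketch \<Rightarrow> 'n set" where
  "universal_nodes S = terminal_node S ` terminals S \<union> initial_node S ` initials S \<union>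
     pb_node S ` pullbacks S \<union> po_node S ` pushouts S \<union> list_node S ` lists S"

lemma primitive_nodes_eq: "primitive_nodes S = nodes S - universal_nodes S"
  by (simp add: primitive_nodes_def universal_nodes_def)

lemma universal_nodes_subset:
  assumes S: "is_sketch S"
  shows "universal_nodes S \<subseteq> nodes S"
proof -
  have "terminal_node S ` terminals S \<subseteq> nodes S" "initial_node S ` initials S \<subseteq> nodes S"
    using S by (auto simp: is_sketch_def)
  moreover have "pb_node S w \<in> nodes S" "src S (pb_leg2 S w) \<in> nodes S" if "w \<in> pullbacks S" for w
    using sketch_edge[OF S sketch_pullback(7)[OF S that]] sketch_edge[OF S sketch_pullback(6)[OF S that]]
    by simp_all
  moreover have "po_node S w \<in> nodes S" if "w \<in> pushouts S" for w
    using sketch_edge[OF S sketch_pushout(7)[OF S that]] by simp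
  ultimately show ?thesis
    unfolding universal_nodes_def by (simp add: image_subset_iff sketch_list(2)[OF S])
qed

lemma universal_nodes_extends:
  assumes "extends_by U V ns es ks ts ws os qs ls"
  shows "universal_nodes V = universal_nodes U \<union> terminal_node V ` set ts \<union> initial_node V ` set os \<union>
     pb_node V ` set ws \<union> po_node V ` set qs \<union> list_node V ` set ls"
proof -
  have UV: "subsketch U V" and eq: "terminals V = terminals U \<union> set ts"
    "pullbacks V = pullbacks U \<union> set ws" "initials V = initials U \<union> set os"
    "pushouts V = pushouts U \<union> set qs" "lists V = lists U \<union> set ls"
    using assms by (simp_all add: extends_by_def adjoins_def)
  have old: "terminal_node V ` terminals U = terminal_node U ` terminals U"
    "initial_node V ` initials U = initial_node U ` initials U"
    "(\<lambda>w. pb_node V w) ` pullbacks U = (\<lambda>w. pb_node U w) ` pullbacks U"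
    "(\<lambda>w. po_node V w) ` pushouts U = (\<lambda>w. po_node U w) ` pushouts U"
    "(\<lambda>l. list_node V l) ` lists U = (\<lambda>l. list_node U l) ` lists U"
    using UV subsketch_pullback(6)[OF UV] subsketch_pushout(5)[OF UV] subsketch_list(5)[OF UV]
    by (auto simp: subsketch_def intro!: image_cong)
  show ?thesis
    unfolding universal_nodes_def eq image_Un old by (simp only: Un_ac)
qed

text \<open>As the universals of an extension bring their own nodes, no node stops being primitive later.\<close>

lemma primitive_nodes_extends:
  assumes ext: "extends_by U V ns es ks ts ws os qs ls"
    and new: "\<forall>t\<in>set ts. terminal_node V t \<in> set ns" "\<forall>t\<in>set os. initial_node V t \<in> set ns"
      "\<forall>w\<in>set ws. pb_node V w \<in> set ns" "\<forall>w\<in>set qs. po_node V w \<in> set ns"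
      "\<forall>l\<in>set ls. list_node V l \<in> set ns"
  shows "primitive_nodes V \<inter> nodes U = primitive_nodes U"
proof -
  have "nodes V = nodes U \<union> set ns" and "set ns \<inter> nodes U = {}"
    using ext by (simp_all add: extends_by_def adjoins_def)
  with new show ?thesis
    unfolding primitive_nodes_eq universal_nodes_extends[OF ext] by blast
qed

text \<open>Strictness at the old ingredients involves the components at old nodes only, so that a family can be
  extended to the new nodes without disturbing it.\<close>

lemma uniquely_straightenable_extends:
  assumes ext: "extends_by U V ns es ks ts ws os qs ls"
    and new: "\<forall>t\<in>set ts. terminal_node V t \<in> set ns" "\<forall>t\<in>set os. initial_node V t \<in> set ns"
      "\<forall>w\<in>set ws. pb_node V w \<in> set ns" "\<forall>w\<in>set qs. po_node V w \<in> set ns"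
      "\<forall>l\<in>set ls. list_node V l \<in> set ns"
    and ex: "\<And>\<phi>. straightens U A M \<phi> \<Longrightarrow> \<exists>\<phi>'. (\<forall>X\<in>nodes U. \<phi>' X = \<phi> X) \<and>
      straightens_at V A M \<phi>' (set ns) (set ts) (set ws) (set os) (set qs) (set ls) \<and>
      (\<forall>X\<in>set ns \<inter> primitive_nodes V. \<phi>' X = Idn A (node_map M X))"
    and uniq: "\<And>\<phi> \<phi>'. straightens U A M \<phi> \<Longrightarrow>
      straightens_at V A M \<phi> (set ns) (set ts) (set ws) (set os) (set qs) (set ls) \<Longrightarrow>
      straightens_at V A M \<phi>' (set ns) (set ts) (set ws) (set os) (set qs) (set ls) \<Longrightarrow>
      (\<forall>X\<in>nodes U. \<phi> X = \<phi>' X) \<Longrightarrow> (\<forall>X\<in>set ns \<inter> primitive_nodes V. \<phi> X = \<phi>' X) \<Longrightarrow>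
      (\<forall>X\<in>set ns. \<phi> X = \<phi>' X)"
    and U: "uniquely_straightenable U A M"
  shows "uniquely_straightenable V A M"
proof -
  have sk: "is_sketch U" and nV: "nodes V = nodes U \<union> set ns"
    using ext by (simp_all add: extends_by_def adjoins_def subsketch_def)
  note prim = primitive_nodes_extends[OF ext new]
  note str = straightens_extends[OF ext]
  obtain \<phi> where \<phi>: "straightens U A M \<phi>" "\<forall>X\<in>primitive_nodes U. \<phi> X = Idn A (node_map M X)"
    using U unfolding uniquely_straightenable_def by blast
  obtain \<phi>' where \<phi>': "\<forall>X\<in>nodes U. \<phi>' X = \<phi> X"
      "straightens_at V A M \<phi>' (set ns) (set ts) (set ws) (set os) (set qs) (set ls)"
      "\<forall>X\<in>set ns \<inter> primitive_nodes V. \<phi>' X = Idn A (node_map M X)"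
    using ex[OF \<phi>(1)] by blast
  have "straightens V A M \<phi>'"
    unfolding str using \<phi>' straightens_cong[OF sk _ \<phi>(1), of \<phi>'] by simp
  moreover have "\<forall>X\<in>primitive_nodes V. \<phi>' X = Idn A (node_map M X)"
  proof
    fix X assume X: "X \<in> primitive_nodes V"
    then have "X \<in> nodes U \<or> X \<in> set ns" using nV by (auto simp: primitive_nodes_def)
    then show "\<phi>' X = Idn A (node_map M X)" using X \<phi> \<phi>' prim by auto
  qed
  moreover have "\<forall>X\<in>nodes V. \<phi> X = \<phi>' X"
    if a: "straightens V A M \<phi>" "straightens V A M \<phi>'" "\<forall>X\<in>primitive_nodes V. \<phi> X = \<phi>' X" for \<phi> \<phi>'
  proof -
    have "\<forall>X\<in>primitive_nodes U. \<phi> X = \<phi>' X" using a(3) prim by blast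
    then have "\<forall>X\<in>nodes U. \<phi> X = \<phi>' X"
      using U a(1,2) unfolding uniquely_straightenable_def str by blast
    moreover from this have "\<forall>X\<in>set ns. \<phi> X = \<phi>' X"
      using a uniq[of \<phi> \<phi>'] unfolding str by blast
    ultimately show ?thesis using nV by blast
  qed
  ultimately show ?thesis unfolding uniquely_straightenable_def by blast
qed

text \<open>The model of the whole context is kept fixed, and the induction runs over the intermediate sketches
  as subsketches of it, so that each universal adjoined on the way is interpreted by a universal
  structure.\<close>

locale au_model = arithmetic_universe A
  for A :: "('o, 'm) au" (structure) +
  fixes T :: "('n, 'e, 'u) sketch" and M :: "('n, 'e, 'o, 'm) interp"
  assumes model_T: "model T A M"
begin

lemma model_edge:
  assumes VT: "subsketch V T" and f: "f \<in> edges V"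
  shows "edge_map M f \<in> Hom A (node_map M (src V f)) (node_map M (tgt V f))"
proof -
  have "f \<in> edges T" using VT f by (auto simp: subsketch_def)
  then show ?thesis
    using model_T interpretation_ofD(1)[of T A M f] subsketch_edge[OF VT f] by (simp add: model_def)
qed

lemma model_node:
  assumes VT: "subsketch V T" and "X \<in> nodes V"
  shows "node_map M X \<in> Obj A"
  using assms model_T interpretation_ofD(2)[of T A M X] by (auto simp: model_def subsketch_def)

lemma model_terminal:
  assumes VT: "subsketch V T" and t: "t \<in> terminals V"
  shows "is_terminal A (node_map M (terminal_node V t))"
proof -
  have "t \<in> terminals T" "terminal_node T t = terminal_node V t"
    using VT t by (auto simp: subsketch_def)
  then show ?thesis using model_T unfolding model_def by metis
qed

lemma model_initial:
  assumes VT: "subsketch V T" and t: "t \<in> initials V"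
  shows "is_initial A (node_map M (initial_node V t))"
proof -
  have "t \<in> initials T" "initial_node T t = initial_node V t"
    using VT t by (auto simp: subsketch_def)
  then show ?thesis using model_T unfolding model_def by metis
qed

lemma model_pullback:
  assumes VT: "subsketch V T" and w: "w \<in> pullbacks V"
  shows "is_pullback A (edge_map M (pb_proj1 V w)) (edge_map M (pb_proj2 V w))
    (edge_map M (pb_leg1 V w)) (edge_map M (pb_leg2 V w))"
proof -
  have "w \<in> pullbacks T" using VT w by (auto simp: subsketch_def)
  then show ?thesis
    using model_T unfolding model_def by (simp flip: subsketch_pullback[OF VT w])
qed

lemma model_pushout:
  assumes VT: "subsketch V T" and w: "w \<in> pushouts V"
  shows "is_pushout A (edge_map M (po_inj1 V w)) (edge_map M (po_inj2 V w))
    (edge_map M (po_leg1 V w)) (edge_map M (po_leg2 V w))"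
proof -
  have "w \<in> pushouts T" using VT w by (auto simp: subsketch_def)
  then show ?thesis
    using model_T unfolding model_def by (simp flip: subsketch_pushout[OF VT w])
qed

lemma model_list:
  assumes VT: "subsketch V T" and l: "l \<in> lists V"
  defines "w \<equiv> list_pullback V l"
  shows "is_list_object A (node_map M (terminal_node V (list_terminal V l)))
    (edge_map M (pb_leg1 V w)) (edge_map M (pb_leg2 V w))
    (edge_map M (pb_proj1 V w)) (edge_map M (pb_proj2 V w))
    (edge_map M (list_eps V l)) (edge_map M (list_cons V l))"
proof -
  have V: "is_sketch V" and lT: "l \<in> lists T" using VT l by (auto simp: subsketch_def)
  have w: "w \<in> pullbacks V" unfolding w_def using sketch_list(2)[OF V l] .
  note e = subsketch_list[OF VT l] subsketch_pullback[OF VT w]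
  have "is_list_object A (node_map M (terminal_node T (list_terminal T l)))
    (edge_map M (pb_leg1 T (list_pullback T l))) (edge_map M (pb_leg2 T (list_pullback T l)))
    (edge_map M (pb_proj1 T (list_pullback T l))) (edge_map M (pb_proj2 T (list_pullback T l)))
    (edge_map M (list_eps T l)) (edge_map M (list_cons T l))"
    using model_T lT unfolding model_def Let_def by blast
  moreover have "list_pullback T l = w" using e(2) by (simp add: w_def)
  ultimately show ?thesis using e by simp
qed

lemma straightenable_primitive_node:
  assumes VT: "subsketch V T" and ext: "extends_by U V [X] [ident V X] [] [] [] [] [] []"
    and U: "uniquely_straightenable U A M"
  shows "uniquely_straightenable V A M"
proof (rule uniquely_straightenable_extends[OF ext _ _ _ _ _ _ _ U])
  have X: "X \<in> nodes V" "X \<notin> nodes U" and sk: "is_sketch U"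
    using ext by (auto simp: extends_by_def adjoins_def subsketch_def)
  have N: "node_map M X \<in> Obj A" using model_node[OF VT X(1)] .
  have prim: "X \<in> primitive_nodes V"
    using X universal_nodes_subset[OF sk] universal_nodes_extends[OF ext] by (auto simp: primitive_nodes_eq)
  show "\<exists>\<phi>'. (\<forall>Y\<in>nodes U. \<phi>' Y = \<phi> Y) \<and>
      straightens_at V A M \<phi>' (set [X]) (set []) (set []) (set []) (set []) (set []) \<and>
      (\<forall>Y\<in>set [X] \<inter> primitive_nodes V. \<phi>' Y = Idn A (node_map M Y))" for \<phi>
    using X N by (intro exI[of _ "\<phi>(X := Idn A (node_map M X))"]) (auto simp: straightens_at_def)
  show "\<forall>Y\<in>set [X]. \<phi> Y = \<phi>' Y" if "\<forall>Y\<in>set [X] \<inter> primitive_nodes V. \<phi> Y = \<phi>' Y" for \<phi> \<phi>'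
    using that prim by simp
qed simp_all

text \<open>The common form of the steps that adjoin a universal with one new node \<open>P\<close>: given the components
  \<open>\<phi>\<close> at the old nodes, strictness at the universal is a condition \<open>Q \<phi>\<close> on the component at \<open>P\<close>
  that has exactly one solution.\<close>

lemma straightenable_one_node:
  assumes ext: "extends_by U V [P] es ks ts ws os qs []"
    and new: "\<forall>t\<in>set ts. terminal_node V t = P" "\<forall>t\<in>set os. initial_node V t = P"
      "\<forall>w\<in>set ws. pb_node V w = P" "\<forall>w\<in>set qs. po_node V w = P"
    and P: "P \<in> universal_nodes V"
    and ex1: "\<And>\<phi>. straightens U A M \<phi> \<Longrightarrow> \<exists>!\<chi>. Q \<phi> \<chi>"
    and iff: "\<And>\<phi> \<phi>'. straightens U A M \<phi> \<Longrightarrow> (\<forall>X\<in>nodes U. \<phi>' X = \<phi> X) \<Longrightarrow>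
      straightens_at V A M \<phi>' {P} (set ts) (set ws) (set os) (set qs) {} \<longleftrightarrow> Q \<phi> (\<phi>' P)"
    and U: "uniquely_straightenable U A M"
  shows "uniquely_straightenable V A M"
proof (rule uniquely_straightenable_extends[OF ext _ _ _ _ _ _ _ U])
  have PU: "P \<notin> nodes U" using ext by (simp add: extends_by_def adjoins_def)
  fix \<phi> assume \<phi>: "straightens U A M \<phi>"
  from ex1[OF \<phi>] obtain \<chi> where \<chi>: "Q \<phi> \<chi>" by blast
  have agree: "\<forall>X\<in>nodes U. (\<phi>(P := \<chi>)) X = \<phi> X" using PU by auto
  have "straightens_at V A M (\<phi>(P := \<chi>)) {P} (set ts) (set ws) (set os) (set qs) {}"
    unfolding iff[OF \<phi>, of "\<phi>(P := \<chi>)", OF agree] using \<chi> by simp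
  moreover have "set [P] \<inter> primitive_nodes V = {}" using P by (simp add: primitive_nodes_eq)
  ultimately show "\<exists>\<phi>'. (\<forall>X\<in>nodes U. \<phi>' X = \<phi> X) \<and>
      straightens_at V A M \<phi>' (set [P]) (set ts) (set ws) (set os) (set qs) (set []) \<and>
      (\<forall>X\<in>set [P] \<inter> primitive_nodes V. \<phi>' X = Idn A (node_map M X))"
    by (intro exI[of _ "\<phi>(P := \<chi>)"] conjI agree) (simp_all only: list.set ball_empty)
  show "\<forall>X\<in>set [P]. \<phi> X = \<phi>' X"
    if "straightens_at V A M \<phi> (set [P]) (set ts) (set ws) (set os) (set qs) (set [])"
      "straightens_at V A M \<phi>' (set [P]) (set ts) (set ws) (set os) (set qs) (set [])"
      "\<forall>X\<in>nodes U. \<phi> X = \<phi>' X" for \<phi>'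
    using that iff[OF \<phi>, of \<phi>] iff[OF \<phi>, of \<phi>'] ex1[OF \<phi>] by auto
qed (use new in simp_all)

lemma straightenable_terminal:
  assumes VT: "subsketch V T" and ext: "extends_by U V [X] [ident V X] [] [t] [] [] [] []"
    and X: "terminal_node V t = X"
    and U: "uniquely_straightenable U A M"
  shows "uniquely_straightenable V A M"
proof (rule straightenable_one_node[OF ext _ _ _ _ _ _ _ U])
  have t: "t \<in> terminals V" using ext by (simp add: extends_by_def adjoins_def)
  then show "X \<in> universal_nodes V" using X by (auto simp: universal_nodes_def)
  show "\<exists>!\<chi>. is_iso A \<chi> \<and> Dom A \<chi> = One A \<and> Cod A \<chi> = node_map M X"
    using terminal_ex1_iso[OF One_terminal model_terminal[OF VT t]] X by simp
  show "straightens_at V A M \<phi>' {X} (set [t]) (set []) (set []) (set []) {} \<longleftrightarrow>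
      is_iso A (\<phi>' X) \<and> Dom A (\<phi>' X) = One A \<and> Cod A (\<phi>' X) = node_map M X" for \<phi>'
    using X unfolding straightens_at_def by simp blast
qed (use X in simp_all)

lemma straightenable_initial:
  assumes VT: "subsketch V T" and ext: "extends_by U V [X] [ident V X] [] [] [] [t] [] []"
    and X: "initial_node V t = X"
    and U: "uniquely_straightenable U A M"
  shows "uniquely_straightenable V A M"
proof (rule straightenable_one_node[OF ext _ _ _ _ _ _ _ U])
  have t: "t \<in> initials V" using ext by (simp add: extends_by_def adjoins_def)
  then show "X \<in> universal_nodes V" using X by (auto simp: universal_nodes_def)
  show "\<exists>!\<chi>. is_iso A \<chi> \<and> Dom A \<chi> = Zero A \<and> Cod A \<chi> = node_map M X"
    using initial_ex1_iso[OF Zero_initial model_initial[OF VT t]] X by simp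
  show "straightens_at V A M \<phi>' {X} (set []) (set []) (set [t]) (set []) {} \<longleftrightarrow>
      is_iso A (\<phi>' X) \<and> Dom A (\<phi>' X) = Zero A \<and> Cod A (\<phi>' X) = node_map M X" for \<phi>'
    using X unfolding straightens_at_def by simp blast
qed (use X in simp_all)

lemma straightenable_pullback:
  assumes VT: "subsketch V T"
    and ext: "extends_by U V [P] es ks [] [w] [] [] []"
    and P: "pb_node V w = P" and legs: "pb_leg1 V w \<in> edges U" "pb_leg2 V w \<in> edges U"
    and U: "uniquely_straightenable U A M"
  shows "uniquely_straightenable V A M"
proof -
  have w: "w \<in> pullbacks V" and UV: "subsketch U V"
    using ext by (simp_all add: extends_by_def adjoins_def)
  have SU: "is_sketch U" and V: "is_sketch V" using UV by (simp_all add: subsketch_def)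
  note s = sketch_pullback[OF V w]
  define p q u v where "p = edge_map M (pb_proj1 V w)" and "q = edge_map M (pb_proj2 V w)"
    and "u = edge_map M (pb_leg1 V w)" and "v = edge_map M (pb_leg2 V w)"
  define X Y Z where "X = src V (pb_leg1 V w)" and "Y = src V (pb_leg2 V w)" and "Z = tgt V (pb_leg1 V w)"
  have nodes: "X \<in> nodes U" "Y \<in> nodes U" "Z \<in> nodes U"
    using subsketch_edge[OF UV legs(1)] subsketch_edge[OF UV legs(2)] sketch_edge[OF SU legs(1)]
      sketch_edge[OF SU legs(2)] by (simp_all add: X_def Y_def Z_def)
  have pb: "is_pullback A p q u v"
    using model_pullback[OF VT w] by (simp add: p_def q_def u_def v_def)
  have N: "Dom A p = node_map M P" "Dom A u = node_map M X" "Dom A v = node_map M Y" "Cod A u = node_map M Z"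
    using model_edge[OF VT s(3)] model_edge[OF VT s(5)] model_edge[OF VT s(6)] s P
    by (simp_all add: p_def u_def v_def X_def Y_def Z_def Hom_def)
  define Q where "Q \<phi> \<chi> \<longleftrightarrow> is_iso A \<chi> \<and> Cod A \<chi> = Dom A p \<and>
    \<chi> \<Zsemi> p \<Zsemi> inv_arr A (\<phi> X) =
      Pb1 A (\<phi> X \<Zsemi> u \<Zsemi> inv_arr A (\<phi> Z)) (\<phi> Y \<Zsemi> v \<Zsemi> inv_arr A (\<phi> Z)) \<and>
    \<chi> \<Zsemi> q \<Zsemi> inv_arr A (\<phi> Y) =
      Pb2 A (\<phi> X \<Zsemi> u \<Zsemi> inv_arr A (\<phi> Z)) (\<phi> Y \<Zsemi> v \<Zsemi> inv_arr A (\<phi> Z))" for \<phi> \<chi>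
  show ?thesis
  proof (rule straightenable_one_node[OF ext, where Q = Q])
    show "P \<in> universal_nodes V" using w P by (auto simp: universal_nodes_def)
    show "\<exists>!\<chi>. Q \<phi> \<chi>" if \<phi>: "straightens U A M \<phi>" for \<phi>
    proof -
      have iso: "is_iso A (\<phi> X)" "is_iso A (\<phi> Y)" "is_iso A (\<phi> Z)"
        "Cod A (\<phi> X) = Dom A u" "Cod A (\<phi> Y) = Dom A v" "Cod A (\<phi> Z) = Cod A u"
        using straightens_iso[OF \<phi>] nodes N by simp_all
      show ?thesis
        unfolding Q_def
        by (rule pullback_ex1_iso[OF pb iso Pb_pullback]) (use iso pullback_simps[OF pb] in simp_all)
    qed
    show "straightens_at V A M \<phi>' {P} (set []) (set [w]) (set []) (set []) {} \<longleftrightarrow> Q \<phi> (\<phi>' P)"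
      if "\<forall>X\<in>nodes U. \<phi>' X = \<phi> X" for \<phi> \<phi>'
      using that nodes s P
      by (simp add: straightens_at_def Q_def conj_edge_def N flip: X_def Y_def Z_def p_def q_def u_def v_def)
  qed (use P U in simp_all)
qed

lemma straightenable_pushout:
  assumes VT: "subsketch V T"
    and ext: "extends_by U V [P] es ks [] [] [] [w] []"
    and P: "po_node V w = P" and legs: "po_leg1 V w \<in> edges U" "po_leg2 V w \<in> edges U"
    and U: "uniquely_straightenable U A M"
  shows "uniquely_straightenable V A M"
proof -
  have w: "w \<in> pushouts V" and UV: "subsketch U V"
    using ext by (simp_all add: extends_by_def adjoins_def)
  have SU: "is_sketch U" and V: "is_sketch V" using UV by (simp_all add: subsketch_def)
  note s = sketch_pushout[OF V w]
  define i j u v where "i = edge_map M (po_inj1 V w)" and "j = edge_map M (po_inj2 V w)"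
    and "u = edge_map M (po_leg1 V w)" and "v = edge_map M (po_leg2 V w)"
  define X Y Z where "X = tgt V (po_leg1 V w)" and "Y = tgt V (po_leg2 V w)" and "Z = src V (po_leg1 V w)"
  have nodes: "X \<in> nodes U" "Y \<in> nodes U" "Z \<in> nodes U"
    using subsketch_edge[OF UV legs(1)] subsketch_edge[OF UV legs(2)] sketch_edge[OF SU legs(1)]
      sketch_edge[OF SU legs(2)] by (simp_all add: X_def Y_def Z_def)
  have po: "is_pushout A i j u v"
    using model_pushout[OF VT w] by (simp add: i_def j_def u_def v_def)
  have N: "Cod A i = node_map M P" "Cod A u = node_map M X" "Cod A v = node_map M Y" "Dom A u = node_map M Z"
    using model_edge[OF VT s(3)] model_edge[OF VT s(5)] model_edge[OF VT s(6)] s P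
    by (simp_all add: i_def u_def v_def X_def Y_def Z_def Hom_def)
  define Q where "Q \<phi> \<chi> \<longleftrightarrow> is_iso A \<chi> \<and> Cod A \<chi> = Cod A i \<and>
    \<phi> X \<Zsemi> i \<Zsemi> inv_arr A \<chi> =
      Po1 A (\<phi> Z \<Zsemi> u \<Zsemi> inv_arr A (\<phi> X)) (\<phi> Z \<Zsemi> v \<Zsemi> inv_arr A (\<phi> Y)) \<and>
    \<phi> Y \<Zsemi> j \<Zsemi> inv_arr A \<chi> =
      Po2 A (\<phi> Z \<Zsemi> u \<Zsemi> inv_arr A (\<phi> X)) (\<phi> Z \<Zsemi> v \<Zsemi> inv_arr A (\<phi> Y))" for \<phi> \<chi>
  show ?thesis
  proof (rule straightenable_one_node[OF ext, where Q = Q])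
    show "P \<in> universal_nodes V" using w P by (auto simp: universal_nodes_def)
    show "\<exists>!\<chi>. Q \<phi> \<chi>" if \<phi>: "straightens U A M \<phi>" for \<phi>
    proof -
      have iso: "is_iso A (\<phi> X)" "is_iso A (\<phi> Y)" "is_iso A (\<phi> Z)"
        "Cod A (\<phi> X) = Cod A u" "Cod A (\<phi> Y) = Cod A v" "Cod A (\<phi> Z) = Dom A u"
        using straightens_iso[OF \<phi>] nodes N by simp_all
      have "u \<in> Arr A" "v \<in> Arr A" "Dom A v = Dom A u" using po by (simp_all add: is_pushout_def)
      then show ?thesis
        unfolding Q_def
        by (intro pushout_ex1_iso[OF po iso] Po_pushout) (use iso in simp_all)
    qed
    show "straightens_at V A M \<phi>' {P} (set []) (set []) (set []) (set [w]) {} \<longleftrightarrow> Q \<phi> (\<phi>' P)"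
      if "\<forall>X\<in>nodes U. \<phi>' X = \<phi> X" for \<phi> \<phi>'
      using that nodes s P
      by (simp add: straightens_at_def Q_def conj_edge_def N flip: X_def Y_def Z_def i_def j_def u_def v_def)
  qed (use P U in simp_all)
qed

lemma straightenable_list:
  assumes VT: "subsketch V T"
    and ext: "extends_by U V [N, L, P] es ks [t] [w] [] [] [l]"
    and eq: "list_terminal V l = t" "list_pullback V l = w" "terminal_node V t = N" "list_node V l = L"
      "pb_node V w = P"
    and arg: "list_arg V l \<in> nodes U"
    and U: "uniquely_straightenable U A M"
  shows "uniquely_straightenable V A M"
proof (rule uniquely_straightenable_extends[OF ext _ _ _ _ _ _ _ U])
  have in_V: "w \<in> pullbacks V" "l \<in> lists V" "t \<in> terminals V" and V: "is_sketch V"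
    and fresh: "distinct [N, L, P]" "N \<notin> nodes U" "L \<notin> nodes U" "P \<notin> nodes U"
    using ext by (simp_all add: extends_by_def adjoins_def subsketch_def)
  define X where "X = list_arg V l"
  note s = sketch_pullback[OF V in_V(1)] sketch_list[OF V in_V(2)]
  have ends: "src V (pb_proj1 V w) = P" "src V (pb_proj2 V w) = P" "tgt V (pb_proj1 V w) = X"
    "tgt V (pb_proj2 V w) = L" "src V (pb_leg1 V w) = X" "src V (pb_leg2 V w) = L"
    "tgt V (pb_leg1 V w) = N" "tgt V (pb_leg2 V w) = N" "src V (list_eps V l) = N"
    "tgt V (list_eps V l) = L" "src V (list_cons V l) = P" "tgt V (list_cons V l) = L"
    using s eq by (simp_all add: X_def)
  define p q u v e c where "p = edge_map M (pb_proj1 V w)" and "q = edge_map M (pb_proj2 V w)"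
    and "u = edge_map M (pb_leg1 V w)" and "v = edge_map M (pb_leg2 V w)"
    and "e = edge_map M (list_eps V l)" and "c = edge_map M (list_cons V l)"
  have lo: "is_list_object A (node_map M N) u v p q e c"
    using model_list[OF VT in_V(2)] eq by (simp add: p_def q_def u_def v_def e_def c_def)
  have dom: "Dom A u = node_map M X" "Dom A v = node_map M L" "Dom A p = node_map M P"
    using model_edge[OF VT s(5)] model_edge[OF VT s(6)] model_edge[OF VT s(3)] ends
    by (simp_all add: u_def v_def p_def Hom_def)
  have XU: "X \<in> nodes U" using arg by (simp add: X_def)
  have prim: "set [N, L, P] \<inter> primitive_nodes V = {}"
    using in_V eq by (auto simp: primitive_nodes_eq universal_nodes_def)
  fix \<phi> assume \<phi>: "straightens U A M \<phi>"
  have a: "is_iso A (\<phi> X)" "Cod A (\<phi> X) = Dom A u" using straightens_iso[OF \<phi> XU] dom by simp_all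
  let ?X = "Dom A (\<phi> X)"
  let ?map = "list_map A (\<phi> X)
    (Pr1 A ?X (List A ?X), Pr2 A ?X (List A ?X), Eps A ?X, Cons A ?X) (p, q, e, c)"
  have X_obj: "?X \<in> Obj A" using a by simp
  note lo0 = List_list_object[OF X_obj]
  have aX: "\<phi> X \<in> Hom A (Dom A (to_terminal A (One A) ?X)) (Dom A u)"
    using a X_obj by (simp add: Hom_def)
  have iff: "straightens_at V A M \<phi>' (set [N, L, P]) (set [t]) (set [w]) (set []) (set []) (set [l]) \<longleftrightarrow>
      ?map (\<phi>' N) (\<phi>' L) (\<phi>' P)" if agree: "\<forall>Y\<in>nodes U. \<phi>' Y = \<phi> Y" for \<phi>'
  proof -
    have X': "\<phi>' X = \<phi> X" using agree XU by simp
    show ?thesis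
      unfolding list_straightening_iff[OF lo a, symmetric]
      using eq by (simp add: straightens_at_def conj_edge_def ends X' dom
          flip: X_def p_def q_def u_def v_def e_def c_def) blast
  qed
  obtain \<tau> f m where map: "?map \<tau> f m"
    using list_map_exists[OF lo0 lo aX] by blast
  have agree: "\<forall>Y\<in>nodes U. (\<phi>(N := \<tau>, L := f, P := m)) Y = \<phi> Y" using fresh by auto
  have "straightens_at V A M (\<phi>(N := \<tau>, L := f, P := m))
      (set [N, L, P]) (set [t]) (set [w]) (set []) (set []) (set [l])"
    unfolding iff[of "\<phi>(N := \<tau>, L := f, P := m)", OF agree] using map fresh by simp
  then show "\<exists>\<phi>'. (\<forall>X\<in>nodes U. \<phi>' X = \<phi> X) \<and>
      straightens_at V A M \<phi>' (set [N, L, P]) (set [t]) (set [w]) (set []) (set []) (set [l]) \<and>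
      (\<forall>X\<in>set [N, L, P] \<inter> primitive_nodes V. \<phi>' X = Idn A (node_map M X))"
    unfolding prim using agree by blast
  show "\<forall>X\<in>set [N, L, P]. \<phi> X = \<phi>' X"
    if "straightens_at V A M \<phi> (set [N, L, P]) (set [t]) (set [w]) (set []) (set []) (set [l])"
      "straightens_at V A M \<phi>' (set [N, L, P]) (set [t]) (set [w]) (set []) (set []) (set [l])"
      "\<forall>X\<in>nodes U. \<phi> X = \<phi>' X" for \<phi>'
  proof -
    have "?map (\<phi> N) (\<phi> L) (\<phi> P)" "?map (\<phi>' N) (\<phi>' L) (\<phi>' P)"
      using that iff[of \<phi>] iff[of \<phi>'] by simp_all
    then show ?thesis using list_map_unique[OF lo0 lo aX] by simp
  qed
qed (use eq in simp_all)

lemma straightenable_no_node: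
  assumes ext: "extends_by U V [] es ks [] [] [] [] []"
    and U: "uniquely_straightenable U A M"
  shows "uniquely_straightenable V A M"
proof (rule uniquely_straightenable_extends[OF ext _ _ _ _ _ _ _ U])
  show "\<exists>\<phi>'. (\<forall>X\<in>nodes U. \<phi>' X = \<phi> X) \<and>
      straightens_at V A M \<phi>' (set []) (set []) (set []) (set []) (set []) (set []) \<and>
      (\<forall>X\<in>set [] \<inter> primitive_nodes V. \<phi>' X = Idn A (node_map M X))" for \<phi>
    by (intro exI[of _ \<phi>]) (simp add: straightens_at_def)
qed simp_all

lemma straightenable_simple_extension:
  assumes "simple_extension U V" "subsketch V T" "uniquely_straightenable U A M"
  shows "uniquely_straightenable V A M"
  using assms(1)
proof cases
  case (primitive_node X)
  then show ?thesis using straightenable_primitive_node assms by blast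
next
  case (primitive_edge f)
  then show ?thesis using straightenable_no_node assms by blast
next
  case (commutativity k)
  then show ?thesis using straightenable_no_node assms by blast
next
  case (terminal_universal X t)
  then show ?thesis using straightenable_terminal assms by blast
next
  case (initial_universal X t)
  then show ?thesis using straightenable_initial assms by blast
next
  case (pullback_universal P w)
  then show ?thesis using straightenable_pullback assms by blast
next
  case (pushout_universal Q w)
  then show ?thesis using straightenable_pushout assms by blast
next
  case (list_universal N L P l w t)
  then show ?thesis using straightenable_list[OF assms(2) list_universal(1)] assms by blast
qed

lemma straightenable_context:
  assumes "is_context T"
  shows "is_sketch T" "uniquely_straightenable T A M"
proof -
  obtain E where E: "empty_sketch E" and ET: "simple_extension\<^sup>*\<^sup>* E T"
    using assms by (auto simp: is_context_def extension_def)
  show T: "is_sketch T"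
    using ET
  proof cases
    case rtrancl_refl
    then show ?thesis using E by (simp add: empty_sketch_def is_sketch_def)
  next
    case (rtrancl_into_rtrancl S)
    then show ?thesis using simple_extension_subsketch[of S T] by (simp add: subsketch_def)
  qed
  have "subsketch S T \<longrightarrow> uniquely_straightenable S A M" if "simple_extension\<^sup>*\<^sup>* E S" for S
    using that
  proof (induction rule: rtranclp_induct)
    case base
    show ?case
      using E by (simp add: uniquely_straightenable_def straightens_def straightens_at_def
          primitive_nodes_def empty_sketch_def)
  next
    case (step U V)
    then show ?case
      using straightenable_simple_extension subsketch_trans simple_extension_subsketch by blast
  qed
  with ET show "uniquely_straightenable T A M" using subsketch_refl[OF T] by blast
qed

end

section \<open>Existence and uniqueness of the strict model\<close>

theorem corollary14:
  fixes T :: "('n, 'e, 'u) sketch"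
    and A :: "('o, 'm) au"
    and M1 :: "('n, 'e, 'o, 'm) interp"
  assumes "is_context T"
    and "arithmetic_universe A"
    and "model T A M1"
  shows "(\<exists>!(M0, \<phi>). strict_model T A M0 \<and> model_iso T A M0 M1 \<phi> \<and>
            (\<forall>X\<in>primitive_nodes T. \<phi> X = Idn A (node_map M1 X))) \<and>
         (\<forall>M \<phi> M' \<phi>'.
            strict_model T A M \<and> model_iso T A M M1 \<phi> \<and>
            strict_model T A M' \<and> model_iso T A M' M1 \<phi>' \<and>
            (\<forall>X\<in>primitive_nodes T. \<phi> X = \<phi>' X) \<longrightarrow>
            M = M' \<and> \<phi> = \<phi>')"
proof -
  interpret au_model A T M1 using assms by (simp add: au_model_def au_model_axioms_def)
  note T = straightenable_context[OF assms(1)]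
  have M1: "interpretation_of T A M1" using assms(3) by (simp add: model_def)
  note iff = strict_model_iso_iff[OF T(1) M1]
  obtain \<phi> where \<phi>: "straightens T A M1 \<phi>" "\<forall>X\<in>primitive_nodes T. \<phi> X = Idn A (node_map M1 X)"
    using T(2) unfolding uniquely_straightenable_def by blast
  let ?\<phi> = "restrict \<phi> (nodes T)"
  have prim: "primitive_nodes T \<subseteq> nodes T" by (auto simp: primitive_nodes_def)
  have "straightens T A M1 ?\<phi>" using straightens_cong[OF T(1) _ \<phi>(1), of ?\<phi>] by simp
  then have ex: "strict_model T A (transport T A M1 ?\<phi>) \<and> model_iso T A (transport T A M1 ?\<phi>) M1 ?\<phi>"
    "\<forall>X\<in>primitive_nodes T. ?\<phi> X = Idn A (node_map M1 X)"
    using iff \<phi>(2) prim by auto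
  have uniq: "M = M' \<and> \<phi> = \<phi>'"
    if "strict_model T A M \<and> model_iso T A M M1 \<phi>" "strict_model T A M' \<and> model_iso T A M' M1 \<phi>'"
      "\<forall>X\<in>primitive_nodes T. \<phi> X = \<phi>' X" for M \<phi> M' \<phi>'
  proof -
    note a = that(1)[unfolded iff] and a' = that(2)[unfolded iff]
    have "\<forall>X\<in>nodes T. \<phi> X = \<phi>' X"
      using T(2) a a' that(3) unfolding uniquely_straightenable_def by blast
    then have "\<phi> = \<phi>'" using a a' by (intro extensionalityI[of \<phi> "nodes T" \<phi>']) auto
    then show ?thesis using a a' by simp
  qed
  show ?thesis
  proof (intro conjI ex1I[of _ "(transport T A M1 ?\<phi>, ?\<phi>)"] allI impI)
    show "case (transport T A M1 ?\<phi>, ?\<phi>) of (M0, \<phi>) \<Rightarrow>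
        strict_model T A M0 \<and> model_iso T A M0 M1 \<phi> \<and>
        (\<forall>X\<in>primitive_nodes T. \<phi> X = Idn A (node_map M1 X))"
      using ex by simp
  next
    fix x assume x: "case x of (M0, \<phi>) \<Rightarrow> strict_model T A M0 \<and> model_iso T A M0 M1 \<phi> \<and>
        (\<forall>X\<in>primitive_nodes T. \<phi> X = Idn A (node_map M1 X))"
    obtain M0 \<psi> where "x = (M0, \<psi>)" by (cases x)
    then show "x = (transport T A M1 ?\<phi>, ?\<phi>)"
      using x uniq[of M0 \<psi> "transport T A M1 ?\<phi>" ?\<phi>] ex by simp
  qed (use uniq in blast)+
qed

end
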